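(* Let $Z$ be a real-valued Lévy process, let $c>0$, and let $\mathcal{E}$ be a vector space of functions on $[0,1]$ such that almost surely all increment functions $\eta_{x,\lambda}$ ($x\ge 0$, $\lambda>0$) of $Z$ lie in $\mathcal{E}$. Let $d$ be a distance on $\mathcal{E}$ and $\mathcal{T}$ a topology on $\mathcal{E}$ (not necessarily metrized by $d$), with Borel $\sigma$-algebra $\mathcal{B}$. Consider the following assumptions. (A1) $\mathcal{D}_0\subset\mathcal{B}\subset\mathcal{B}_{\mathcal{S}}$, where $\mathcal{D}_0$ is the $\sigma$-algebra generated by the open balls of $(\mathcal{E},d)$. (A2) The family $(P_\lambda)_{\lambda>0}$ satisfies a large deviations principle in $(\mathcal{E},\mathcal{T})$ with a good rate function $\mathcal{I}$. (A3) For every $\alpha>0$ there is a convex subset $E_\alpha$ of $\mathcal{E}$ containing the null function $0_{\mathcal{E}}$, such that $\mathcal{K}_\alpha:=\{f\in\mathcal{E}:\mathcal{I}(f)\le\alpha\}\subset E_\alpha$ and $d$ metrizes the restriction of $\mathcal{T}$ to $E_\alpha$. (A4) There is a distance $\delta$ on $\mathcal{E}$ such that (i) the topology induced by $\delta$ on $\mathcal{E}$ is weaker than $\mathcal{T}$, and (ii) for all $\alpha>0$, every compact $K$ of $(E_\alpha,d)$, every $g\in K$ and every $\epsilon>0$, there is $\zeta>0$ such that $\{f\in\mathcal{E}:\delta(f,g)<\zeta\}\subset\{f\in\mathcal{E}:d(f,g)<\epsilon\}$. (A5) For every $\alpha>0$, $\mathcal{I}$ is convex on $E_\alpha$, and $\mathcal{I}(0_{\mathcal{E}})=0$.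 Then: (i) If (A1)–(A5) hold, then the functional Erdős–Rényi law (FERL) holds for $(\mathcal{L}_n^{\mathbb{N}})$ in $(\mathcal{E},d)$ with limit set $\mathcal{K}_{1/c}$. (ii) If (A1)–(A5) hold and moreover condition $(\Delta^d)$ holds, then the FERL holds for $(\mathcal{L}_n)$ in $(\mathcal{E},d)$ with limit set $\mathcal{K}_{1/c}$.
   Context: A Lévy process $Z=\{Z(t):t\ge0\}$ is a stochastically continuous real-valued process with stationary independent increments and $Z(0)=0$ a.s.; it is defined on a probability space $(\Omega,\mathcal{F},P)$, and all its sample paths are assumed càdlàg on $[0,\infty)$. For $x\ge0$ and $\lambda>0$, the increment function is $\eta_{x,\lambda}:[0,1]\to\mathbb{R}$, $\eta_{x,\lambda}(s)=\lambda^{-1}(Z(x+s\lambda)-Z(x))$. $P_\lambda$ denotes the distribution of $\eta_{0,\lambda}=\lambda^{-1}Z(\lambda\,\cdot)$. For $n>1$, $A_n:=\lfloor c\log n\rfloor$; $\mathcal{L}_n:=\{\eta_{x,A_n}:x\in[0,n-A_n]\}$ and $\mathcal{L}_n^{\mathbb{N}}:=\{\eta_{x,A_n}:x\in[0,n-A_n]\cap\mathbb{N}\}$, with $0\in\mathbb{N}$. Only integers $n$ with $1\le A_n\le n$ are considered (this holds for all large $n$). $D(0,1)$ is the set of càdlàg functions on $[0,1]$, and $\mathcal{B}_{\mathcal{S}}$ is the Borel $\sigma$-algebra of the Skorokhod topology $\mathcal{S}$ on $D(0,1)$. A rate function on a topological space is a lower semicontinuous function with values in $[0,\infty]$; it is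 good if its sublevel sets are compact. $(P_\lambda)_{\lambda>0}$ satisfies a large deviations principle with rate function $\mathcal{I}$ if $\limsup_{\lambda\to\infty}\lambda^{-1}\log P_\lambda(F)\le-\inf_F\mathcal{I}$ for every closed $F$ and $\liminf_{\lambda\to\infty}\lambda^{-1}\log P_\lambda(G)\ge-\inf_G\mathcal{I}$ for every open $G$. A subset of $\Omega$ is negligible if it is contained in a set of $\mathcal{F}$ of probability $0$; $\mathcal{N}$ is the class of negligible sets and $\mathcal{N}^{c}$ the class of their complements. For subsets $E_n$ of $\Omega$, $\{E_n\text{ ult.}\}=\bigcup_{n>1}\bigcap_{k\ge n}E_k$ and $\{E_n\text{ i.o.}\}=\bigcap_{n>1}\bigcup_{k\ge n}E_k$. For $K\subset\mathcal{E}$ and $\epsilon>0$, $K^{\epsilon;d}:=\{f\in\mathcal{E}:\exists g\in K,\ d(f,g)<\epsilon\}$. A FERL holds for $(\mathcal{L}_n)$ in $(\mathcal{E},d)$ with limit set $\mathcal{K}\subset\mathcal{E}$ if for every $\epsilon>0$, $\{\mathcal{L}_n\subset\mathcal{K}^{\epsilon;d}\text{ ult.}\}\in\mathcal{N}^{c}$ and $\{\mathcal{K}\subset(\mathcal{L}_n)^{\epsilon;d}\text{ ult.}\}\in\mathcal{N}^{c}$; similarly for $(\mathcal{L}_n^{\mathbb{N}})$. Condition $(\Delta^d)$: for all $\epsilon>0$, $\{\Delta_n^d(\epsilon)\text{ i.o.}\}\in\mathcal{N}$, where $\Delta_n^d(\epsilon):=\{\exists x\in[0,n-A_n]\text{ such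 that }d(\eta_{x,A_n},\eta_{\lfloor x\rfloor,A_n})\ge\epsilon\}$.
   Formalization: Adds the assumption that for each f in K_{1/c}, d(uf, f) → 0 as u → 1 from below; without any link between d and scalar multiplication the claim fails (a relabelled Skorokhod metric for a compensated Poisson process). *)

theory Defs
  imports "HOL-Probability.Probability"
begin

section \<open>Functions on the unit interval\<close>

text \<open>
  A function on \<open>[0,1]\<close> is represented by a function on \<open>\<real>\<close> that vanishes outside \<open>[0,1]\<close>,
  so that equality, the null function and the linear operations are the pointwise ones.
\<close>

type_synonym path = "real \<Rightarrow> real"

definition unit_functions :: "path set" where
  "unit_functions = {f. \<forall>s. s \<notin> {0..1} \<longrightarrow> f s = 0}"

definition null_path :: path where
  "null_path = (\<lambda>s. 0)"

definition function_vector_space :: "path set \<Rightarrow> bool" where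
  "function_vector_space E \<longleftrightarrow>
     E \<subseteq> unit_functions \<and> null_path \<in> E \<and>
     (\<forall>f\<in>E. \<forall>g\<in>E. (\<lambda>s. f s + g s) \<in> E) \<and>
     (\<forall>a. \<forall>f\<in>E. (\<lambda>s. a * f s) \<in> E)"

definition convex_paths :: "path set \<Rightarrow> bool" where
  "convex_paths C \<longleftrightarrow>
     (\<forall>f\<in>C. \<forall>g\<in>C. \<forall>u\<in>{0..1::real}. (\<lambda>s. (1 - u) * f s + u * g s) \<in> C)"

definition convex_functional_on :: "path set \<Rightarrow> (path \<Rightarrow> ereal) \<Rightarrow> bool" where
  "convex_functional_on C J \<longleftrightarrow>
     (\<forall>f\<in>C. \<forall>g\<in>C. \<forall>u\<in>{0..1::real}.
        J (\<lambda>s. (1 - u) * f s + u * g s) \<le> ereal (1 - u) * J f + ereal u * J g)"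


section \<open>The Skorokhod space\<close>

text \<open>
  At an endpoint belonging to \<open>S\<close>, the one-sided filter pointing out of \<open>S\<close> is trivial and
  imposes no condition.
\<close>

definition cadlag_on :: "real set \<Rightarrow> (real \<Rightarrow> real) \<Rightarrow> bool" where
  "cadlag_on S f \<longleftrightarrow>
     (\<forall>t\<in>S. (f \<longlongrightarrow> f t) (at t within S \<inter> {t<..}) \<and>
            (\<exists>l. (f \<longlongrightarrow> l) (at t within S \<inter> {..<t})))"

definition cadlag_paths :: "path set" where
  "cadlag_paths = {f \<in> unit_functions. cadlag_on {0..1} f}"

definition time_changes :: "(real \<Rightarrow> real) set" where
  "time_changes =
     {h. continuous_on {0..1} h \<and> strict_mono_on {0..1} h \<and> h 0 = 0 \<and> h 1 = 1}"

definition skorokhod_cost :: "path \<Rightarrow> path \<Rightarrow> (real \<Rightarrow> real) \<Rightarrow> ennreal" where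
  "skorokhod_cost f g h =
     (SUP t\<in>{0..1}. ennreal (max \<bar>h t - t\<bar> \<bar>f t - g (h t)\<bar>))"

definition skorokhod_dist :: "path \<Rightarrow> path \<Rightarrow> real" where
  "skorokhod_dist f g = enn2real (INF h\<in>time_changes. skorokhod_cost f g h)"

lemma id_time_change: "(\<lambda>t. t) \<in> time_changes"
  by (auto simp: time_changes_def strict_mono_on_def)

lemma time_change_range:
  assumes "h \<in> time_changes" "t \<in> {0..1}"
  shows "h t \<in> {0..1}"
proof -
  have m: "mono_on {0..1} h"
    using assms(1) by (auto simp: time_changes_def intro: strict_mono_on_imp_mono_on)
  show ?thesis
    using mono_onD[OF m, of 0 t] mono_onD[OF m, of t 1] assms by (auto simp: time_changes_def)
qed

lemma time_change_surj:
  assumes "h \<in> time_changes" "y \<in> {0..1}"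
  shows "\<exists>t\<in>{0..1}. h t = y"
  using IVT'[of h 0 y 1] assms by (fastforce simp: time_changes_def)

lemma time_change_bij:
  assumes "h \<in> time_changes"
  shows "bij_betw h {0..1} {0..1}"
  unfolding bij_betw_def
proof
  show "inj_on h {0..1}"
    using assms by (auto simp: time_changes_def intro: strict_mono_on_imp_inj_on)
  show "h ` {0..1} = {0..1}"
  proof
    show "h ` {0..1} \<subseteq> {0..1}" using time_change_range[OF assms] by blast
    show "{0..1} \<subseteq> h ` {0..1}" using time_change_surj[OF assms] by (blast intro: sym)
  qed
qed

lemma time_change_comp:
  assumes "h \<in> time_changes" "k \<in> time_changes"
  shows "(\<lambda>t. k (h t)) \<in> time_changes"
proof -
  have "continuous_on {0..1} (\<lambda>t. k (h t))"
    by (rule continuous_on_compose2[of "{0..1}" k])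
      (use assms time_change_range[OF assms(1)] in \<open>auto simp: time_changes_def\<close>)
  moreover have "strict_mono_on {0..1} (\<lambda>t. k (h t))"
  proof (rule strict_mono_onI)
    fix r s :: real assume rs: "r \<in> {0..1}" "s \<in> {0..1}" "r < s"
    then have "h r < h s"
      using assms(1) by (auto simp: time_changes_def strict_mono_on_def)
    then show "k (h r) < k (h s)"
      using assms(2) time_change_range[OF assms(1)] rs
      by (auto simp: time_changes_def strict_mono_on_def)
  qed
  ultimately show ?thesis
    using assms by (simp add: time_changes_def)
qed

lemma time_change_inv:
  assumes "h \<in> time_changes"
  shows "inv_into {0..1} h \<in> time_changes"
proof -
  let ?k = "inv_into {0..1} h"
  have inj: "inj_on h {0..1}" and im: "h ` {0..1} = {0..1}"
    using time_change_bij[OF assms] by (auto simp: bij_betw_def)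
  have "continuous_on (h ` {0..1}) ?k"
    by (rule continuous_on_inv) (use assms inj in \<open>auto simp: time_changes_def\<close>)
  then have 1: "continuous_on {0..1} ?k" by (simp add: im)
  have 2: "strict_mono_on {0..1} ?k"
  proof (rule strict_mono_onI)
    fix r s :: real assume rs: "r \<in> {0..1}" "s \<in> {0..1}" "r < s"
    have m: "mono_on {0..1} h"
      using assms by (auto simp: time_changes_def intro: strict_mono_on_imp_mono_on)
    have k: "?k r \<in> {0..1}" "?k s \<in> {0..1}"
      using rs im by (metis inv_into_into)+
    have hk: "h (?k r) = r" "h (?k s) = s"
      using rs im by (metis f_inv_into_f)+
    show "?k r < ?k s"
      using mono_onD[OF m k(2) k(1)] hk rs(3) by force
  qed
  have 3: "?k 0 = 0" "?k 1 = 1"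
    using inv_into_f_f[OF inj, of 0] inv_into_f_f[OF inj, of 1] assms
    by (auto simp: time_changes_def)
  show ?thesis using 1 2 3 by (simp add: time_changes_def)
qed

lemma skorokhod_cost_le_iff:
  "skorokhod_cost f g h \<le> ennreal e \<longleftrightarrow>
     (\<forall>t\<in>{0..1}. \<bar>h t - t\<bar> \<le> e \<and> \<bar>f t - g (h t)\<bar> \<le> e)" if "e \<ge> 0"
  using that unfolding skorokhod_cost_def SUP_le_iff by (auto simp: ennreal_le_iff)

lemma skorokhod_cost_inv:
  assumes "h \<in> time_changes"
  shows "skorokhod_cost g f (inv_into {0..1} h) \<le> skorokhod_cost f g h"
  unfolding skorokhod_cost_def
proof (rule SUP_mono)
  fix t :: real assume t: "t \<in> {0..1}"
  let ?k = "inv_into {0..1} h"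
  have im: "h ` {0..1} = {0..1}"
    using time_change_bij[OF assms] by (auto simp: bij_betw_def)
  have "?k t \<in> {0..1}" "h (?k t) = t"
    using t im by (metis inv_into_into, metis f_inv_into_f)
  then show "\<exists>m\<in>{0..1}. ennreal (max \<bar>?k t - t\<bar> \<bar>g t - f (?k t)\<bar>)
      \<le> ennreal (max \<bar>h m - m\<bar> \<bar>f m - g (h m)\<bar>)"
    by (intro bexI[of _ "?k t"]) (auto simp: abs_minus_commute)
qed

lemma skorokhod_dist_commute: "skorokhod_dist f g = skorokhod_dist g f"
proof -
  have "(INF h\<in>time_changes. skorokhod_cost f g h) \<le> (INF h\<in>time_changes. skorokhod_cost g f h)"
    for f g
    by (rule INF_mono) (use skorokhod_cost_inv time_change_inv in blast)
  then show ?thesis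
    unfolding skorokhod_dist_def by (metis antisym)
qed

lemma cadlag_paths_bounded:
  assumes "f \<in> cadlag_paths"
  shows "\<exists>B\<ge>0. \<forall>t\<in>{0..1}. \<bar>f t\<bar> \<le> B"
proof -
  have loc: "\<exists>U B. open U \<and> t \<in> U \<and> (\<forall>s\<in>U \<inter> {0..1}. \<bar>f s\<bar> \<le> B)" if t: "t \<in> {0..1}" for t
  proof -
    have r: "(f \<longlongrightarrow> f t) (at t within {0..1} \<inter> {t<..})"
      and "\<exists>l. (f \<longlongrightarrow> l) (at t within {0..1} \<inter> {..<t})"
      using assms t by (simp_all add: cadlag_paths_def cadlag_on_def)
    then obtain l where l: "(f \<longlongrightarrow> l) (at t within {0..1} \<inter> {..<t})"
      by blast
    have "\<forall>\<^sub>F s in at t within {0..1} \<inter> {t<..}. dist (f s) (f t) < 1"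
      using tendstoD[OF r] by simp
    then obtain U where U: "open U" "t \<in> U"
        "\<forall>s\<in>U. s \<noteq> t \<longrightarrow> s \<in> {0..1} \<inter> {t<..} \<longrightarrow> dist (f s) (f t) < 1"
      unfolding eventually_at_topological by blast
    have "\<forall>\<^sub>F s in at t within {0..1} \<inter> {..<t}. dist (f s) l < 1"
      using tendstoD[OF l] by simp
    then obtain V where V: "open V" "t \<in> V"
        "\<forall>s\<in>V. s \<noteq> t \<longrightarrow> s \<in> {0..1} \<inter> {..<t} \<longrightarrow> dist (f s) l < 1"
      unfolding eventually_at_topological by blast
    have "\<bar>f s\<bar> \<le> \<bar>f t\<bar> + \<bar>l\<bar> + 1" if s: "s \<in> (U \<inter> V) \<inter> {0..1}" for s
    proof (cases s t rule: linorder_cases)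
      case less
      then have "dist (f s) l < 1" using V(3) s by auto
      then show ?thesis by (auto simp: dist_real_def)
    next
      case greater
      then have "dist (f s) (f t) < 1" using U(3) s by auto
      then show ?thesis by (auto simp: dist_real_def)
    qed simp
    then show ?thesis
      using U V by (intro exI[of _ "U \<inter> V"] exI[of _ "\<bar>f t\<bar> + \<bar>l\<bar> + 1"]) auto
  qed
  then obtain U B where UB: "\<And>t. t \<in> {0..1} \<Longrightarrow>
      open (U t) \<and> t \<in> U t \<and> (\<forall>s\<in>U t \<inter> {0..1}. \<bar>f s\<bar> \<le> B t)"
    by metis
  obtain C where C: "C \<subseteq> {0..1}" "finite C" "{0..1::real} \<subseteq> (\<Union>t\<in>C. U t)"
    by (rule compactE_image[of "{0..1::real}" "{0..1}" U]) (use UB in auto)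
  have "\<bar>f t\<bar> \<le> (\<Sum>c\<in>C. \<bar>B c\<bar>)" if t: "t \<in> {0..1}" for t
  proof -
    obtain c where c: "c \<in> C" "t \<in> U c" using C(3) t by blast
    have "\<bar>f t\<bar> \<le> B c" using UB[of c] c C(1) t by blast
    also have "\<dots> \<le> \<bar>B c\<bar>" by simp
    also have "\<dots> \<le> (\<Sum>c\<in>C. \<bar>B c\<bar>)"
      by (rule member_le_sum) (use c C in auto)
    finally show ?thesis .
  qed
  then show ?thesis by (intro exI[of _ "\<Sum>c\<in>C. \<bar>B c\<bar>"]) (auto simp: sum_nonneg)
qed

lemma skorokhod_INF_finite:
  assumes "f \<in> cadlag_paths" "g \<in> cadlag_paths"
  shows "(INF h\<in>time_changes. skorokhod_cost f g h) < \<infinity>"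
proof -
  obtain B C where B: "B \<ge> 0" "\<forall>t\<in>{0..1}. \<bar>f t\<bar> \<le> B" and C: "C \<ge> 0" "\<forall>t\<in>{0..1}. \<bar>g t\<bar> \<le> C"
    using cadlag_paths_bounded assms by metis
  have "(INF h\<in>time_changes. skorokhod_cost f g h) \<le> skorokhod_cost f g (\<lambda>t. t)"
    by (rule INF_lower) (rule id_time_change)
  also have "\<dots> \<le> ennreal (B + C)"
    using B C by (subst skorokhod_cost_le_iff) fastforce+
  also have "\<dots> < \<infinity>" by simp
  finally show ?thesis .
qed

lemma skorokhod_dist_less_iff:
  assumes "f \<in> cadlag_paths" "g \<in> cadlag_paths"
  shows "skorokhod_dist f g < e \<longleftrightarrow>
    (\<exists>r. 0 \<le> r \<and> r < e \<and>
      (\<exists>h\<in>time_changes. \<forall>t\<in>{0..1}. \<bar>h t - t\<bar> \<le> r \<and> \<bar>f t - g (h t)\<bar> \<le> r))"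
proof
  let ?I = "INF h\<in>time_changes. skorokhod_cost f g h"
  have I: "?I = ennreal (skorokhod_dist f g)"
    using skorokhod_INF_finite[OF assms] by (simp add: skorokhod_dist_def)
  assume l: "skorokhod_dist f g < e"
  obtain r where r: "skorokhod_dist f g < r" "r < e" using dense[OF l] by blast
  have r0: "0 \<le> r" using r(1) enn2real_nonneg[of ?I] unfolding skorokhod_dist_def by linarith
  have "?I < ennreal r" unfolding I using r(1)
    by (simp add: ennreal_less_iff skorokhod_dist_def[of f g])
  then obtain h where h: "h \<in> time_changes" "skorokhod_cost f g h < ennreal r"
    by (auto simp: INF_less_iff)
  then have "\<forall>t\<in>{0..1}. \<bar>h t - t\<bar> \<le> r \<and> \<bar>f t - g (h t)\<bar> \<le> r"
    using skorokhod_cost_le_iff[OF r0, of f g h] by (simp only: less_imp_le simp_thms)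
  then show "\<exists>r. 0 \<le> r \<and> r < e \<and>
      (\<exists>h\<in>time_changes. \<forall>t\<in>{0..1}. \<bar>h t - t\<bar> \<le> r \<and> \<bar>f t - g (h t)\<bar> \<le> r)"
    using h(1) r0 r(2) by blast
next
  let ?I = "INF h\<in>time_changes. skorokhod_cost f g h"
  assume "\<exists>r. 0 \<le> r \<and> r < e \<and>
      (\<exists>h\<in>time_changes. \<forall>t\<in>{0..1}. \<bar>h t - t\<bar> \<le> r \<and> \<bar>f t - g (h t)\<bar> \<le> r)"
  then obtain r h where r: "0 \<le> r" "r < e" "h \<in> time_changes"
      "\<forall>t\<in>{0..1}. \<bar>h t - t\<bar> \<le> r \<and> \<bar>f t - g (h t)\<bar> \<le> r"
    by blast
  have "skorokhod_cost f g h \<le> ennreal r"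
    using r(4) skorokhod_cost_le_iff[OF r(1), of f g h] by blast
  then have "?I \<le> ennreal r" using r(3) by (rule INF_lower2[rotated])
  then have "skorokhod_dist f g \<le> r"
    unfolding skorokhod_dist_def using r(1) by (intro enn2real_leI)
  then show "skorokhod_dist f g < e" using r by simp
qed

lemma skorokhod_dist_zero_imp_eq:
  assumes f: "f \<in> cadlag_paths" and g: "g \<in> cadlag_paths" and z: "skorokhod_dist f g = 0"
  shows "f = g"
proof
  fix t :: real
  have near: "\<exists>u\<in>{0..1}. \<bar>u - t\<bar> < e \<and> \<bar>f t - g u\<bar> < e \<and> (t = 1 \<longrightarrow> u = 1)" 
    if e: "e > 0" and t: "t \<in> {0..1}" for e t
  proof -
    obtain r h where r: "r < e" "h \<in> time_changes"
        "\<forall>t\<in>{0..1}. \<bar>h t - t\<bar> \<le> r \<and> \<bar>f t - g (h t)\<bar> \<le> r"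
      using skorokhod_dist_less_iff[OF f g, of e] z e by auto
    have "\<bar>h t - t\<bar> \<le> r" "\<bar>f t - g (h t)\<bar> \<le> r" using r(3) t by blast+
    then have "\<bar>h t - t\<bar> < e" "\<bar>f t - g (h t)\<bar> < e" using r(1) by linarith+
    moreover have "t = 1 \<longrightarrow> h t = 1" using r(2) by (simp add: time_changes_def)
    ultimately show ?thesis using time_change_range[OF r(2) t] by blast
  qed
  consider "t \<notin> {0..1}" | "t = 1" | "0 \<le> t" "t < 1" by fastforce
  then show "f t = g t"
  proof cases
    case 1
    then show ?thesis using f g by (simp add: cadlag_paths_def unit_functions_def)
  next
    case 2
    have "\<bar>f 1 - g 1\<bar> < e" if "e > 0" for e using near[OF that, of 1] by auto
    from this[of "\<bar>f 1 - g 1\<bar>"] show ?thesis using 2 by fastforce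
  next
    case 3
    then have t: "t \<in> {0..1}" by simp
    have rf: "(f \<longlongrightarrow> f t) (at t within {0..1} \<inter> {t<..})"
      and rg: "(g \<longlongrightarrow> g t) (at t within {0..1} \<inter> {t<..})"
      using f g t by (auto simp: cadlag_paths_def cadlag_on_def)
    show ?thesis
    proof (rule ccontr)
      assume ne: "f t \<noteq> g t"
      define e where "e = \<bar>f t - g t\<bar> / 3"
      have e: "e > 0" using ne by (simp add: e_def)
      obtain a where a: "a > 0" "\<And>s. s \<in> {0..1} \<Longrightarrow> s > t \<Longrightarrow> s - t < a \<Longrightarrow> \<bar>f s - f t\<bar> < e"
        using tendstoD[OF rf e] unfolding eventually_at by (fastforce simp: dist_real_def)
      obtain b where b: "b > 0" "\<And>s. s \<in> {0..1} \<Longrightarrow> s > t \<Longrightarrow> s - t < b \<Longrightarrow> \<bar>g s - g t\<bar> < e"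
        using tendstoD[OF rg e] unfolding eventually_at by (fastforce simp: dist_real_def)
      define m where "m = min (min a b) (1 - t) / 2"
      have m: "m > 0" "2 * m \<le> a" "2 * m \<le> b" "2 * m \<le> 1 - t"
        using a(1) b(1) 3 by (auto simp: m_def)
      define s where "s = t + m"
      have s: "s \<in> {0..1}" using 3 m by (auto simp: s_def)
      obtain u where u: "u \<in> {0..1}" "\<bar>u - s\<bar> < min e m" "\<bar>f s - g u\<bar> < min e m"
        using near[of "min e m" s] e m(1) s by (metis min_less_iff_conj)
      have "\<bar>f s - f t\<bar> < e" using a(2)[of s] s m by (simp add: s_def)
      moreover have "\<bar>g u - g t\<bar> < e" using b(2)[of u] u m by (auto simp: s_def)
      ultimately have "\<bar>f t - g t\<bar> < 3 * e" using u by linarith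
      then show False by (simp add: e_def)
    qed
  qed
qed

lemma Metric_space_skorokhod: "Metric_space cadlag_paths skorokhod_dist"
proof
  show "0 \<le> skorokhod_dist f g" for f g by (simp add: skorokhod_dist_def)
  show "skorokhod_dist f g = skorokhod_dist g f" for f g by (rule skorokhod_dist_commute)
  show "skorokhod_dist f g = 0 \<longleftrightarrow> f = g" if "f \<in> cadlag_paths" "g \<in> cadlag_paths" for f g
  proof
    assume eq: "f = g"
    have "skorokhod_cost f f (\<lambda>t. t) \<le> ennreal 0"
      by (subst skorokhod_cost_le_iff) auto
    then have "(INF h\<in>time_changes. skorokhod_cost f g h) \<le> 0"
      using INF_lower[OF id_time_change, of "skorokhod_cost f f"] eq by simp
    then show "skorokhod_dist f g = 0" by (simp add: skorokhod_dist_def)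
  qed (use skorokhod_dist_zero_imp_eq that in blast)
  show "skorokhod_dist f k \<le> skorokhod_dist f g + skorokhod_dist g k"
    if D: "f \<in> cadlag_paths" "g \<in> cadlag_paths" "k \<in> cadlag_paths" for f g k
  proof (rule field_le_epsilon)
    fix e :: real assume e: "e > 0"
    obtain r h where r: "0 \<le> r" "r < skorokhod_dist f g + e / 2" "h \<in> time_changes"
        "\<forall>t\<in>{0..1}. \<bar>h t - t\<bar> \<le> r \<and> \<bar>f t - g (h t)\<bar> \<le> r"
      using skorokhod_dist_less_iff[OF D(1,2), of "skorokhod_dist f g + e / 2"] e by auto
    obtain q j where q: "0 \<le> q" "q < skorokhod_dist g k + e / 2" "j \<in> time_changes"
        "\<forall>t\<in>{0..1}. \<bar>j t - t\<bar> \<le> q \<and> \<bar>g t - k (j t)\<bar> \<le> q"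
      using skorokhod_dist_less_iff[OF D(2,3), of "skorokhod_dist g k + e / 2"] e by auto
    have "\<bar>j (h t) - t\<bar> \<le> r + q \<and> \<bar>f t - k (j (h t))\<bar> \<le> r + q" if t: "t \<in> {0..1}" for t
    proof -
      have "\<bar>h t - t\<bar> \<le> r" "\<bar>f t - g (h t)\<bar> \<le> r" using r t by auto
      moreover have "\<bar>j (h t) - h t\<bar> \<le> q" "\<bar>g (h t) - k (j (h t))\<bar> \<le> q"
        using q time_change_range[OF r(3) t] by auto
      ultimately show ?thesis by linarith
    qed
    then have "\<exists>h\<in>time_changes. \<forall>t\<in>{0..1}. \<bar>h t - t\<bar> \<le> r + q \<and> \<bar>f t - k (h t)\<bar> \<le> r + q"
      by (intro bexI[OF _ time_change_comp[OF r(3) q(3)]]) blast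
    moreover have "0 \<le> r + q" "r + q < skorokhod_dist f g + skorokhod_dist g k + e"
      using r q by linarith+
    ultimately have "skorokhod_dist f k < skorokhod_dist f g + skorokhod_dist g k + e"
      using skorokhod_dist_less_iff[OF D(1,3)] by blast
    then show "skorokhod_dist f k \<le> skorokhod_dist f g + skorokhod_dist g k + e" by simp
  qed
qed

definition skorokhod_topology :: "path topology" where
  "skorokhod_topology = Metric_space.mtopology cadlag_paths skorokhod_dist"

definition borel_of :: "'b topology \<Rightarrow> 'b measure" where
  "borel_of T = sigma (topspace T) {U. openin T U}"

definition ball_sigma_algebra :: "'b set \<Rightarrow> ('b \<Rightarrow> 'b \<Rightarrow> real) \<Rightarrow> 'b set set" where
  "ball_sigma_algebra E d = sigma_sets E {Metric_space.mball E d f r | f r. f \<in> E \<and> 0 < r}"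


section \<open>Large deviations\<close>

definition ln_ereal :: "real \<Rightarrow> ereal" where
  "ln_ereal p = (if p \<le> 0 then - \<infinity> else ereal (ln p))"

definition rate_function :: "'b topology \<Rightarrow> ('b \<Rightarrow> ereal) \<Rightarrow> bool" where
  "rate_function T J \<longleftrightarrow>
     (\<forall>f\<in>topspace T. 0 \<le> J f) \<and>
     (\<forall>a::real. openin T {f \<in> topspace T. ereal a < J f})"

definition good_rate_function :: "'b topology \<Rightarrow> ('b \<Rightarrow> ereal) \<Rightarrow> bool" where
  "good_rate_function T J \<longleftrightarrow>
     rate_function T J \<and> (\<forall>a::real. compactin T {f \<in> topspace T. J f \<le> ereal a})"

definition large_deviations :: "'b topology \<Rightarrow> (real \<Rightarrow> 'b measure) \<Rightarrow> ('b \<Rightarrow> ereal) \<Rightarrow> bool" where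
  "large_deviations T P J \<longleftrightarrow>
     rate_function T J \<and>
     (\<forall>F. closedin T F \<longrightarrow>
        Limsup at_top (\<lambda>l. ereal (1 / l) * ln_ereal (measure (P l) F)) \<le> - (INF f\<in>F. J f)) \<and>
     (\<forall>G. openin T G \<longrightarrow>
        - (INF f\<in>G. J f) \<le> Liminf at_top (\<lambda>l. ereal (1 / l) * ln_ereal (measure (P l) G)))"

definition level_set :: "path set \<Rightarrow> (path \<Rightarrow> ereal) \<Rightarrow> real \<Rightarrow> path set" where
  "level_set E J a = {f \<in> E. J f \<le> ereal a}"


section \<open>L\'evy processes and their increment functions\<close>

definition levy_process :: "'a measure \<Rightarrow> (real \<Rightarrow> 'a \<Rightarrow> real) \<Rightarrow> bool" where
  "levy_process M Z \<longleftrightarrow>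
     prob_space M \<and>
     (\<forall>t\<ge>0. Z t \<in> borel_measurable M) \<and>
     (AE \<omega> in M. Z 0 \<omega> = 0) \<and>
     (\<forall>s\<ge>0. \<forall>h\<ge>0. distr M borel (\<lambda>\<omega>. Z (s + h) \<omega> - Z s \<omega>) =
                    distr M borel (\<lambda>\<omega>. Z h \<omega> - Z 0 \<omega>)) \<and>
     (\<forall>(n::nat) t. 0 \<le> t 0 \<and> (\<forall>i<n. t i \<le> t (Suc i)) \<longrightarrow>
        prob_space.indep_vars M (\<lambda>_. borel) (\<lambda>i \<omega>. Z (t (Suc i)) \<omega> - Z (t i) \<omega>) {..<n}) \<and>
     (\<forall>t\<ge>0. \<forall>\<epsilon>>0.
        ((\<lambda>s. measure M {\<omega> \<in> space M. \<epsilon> \<le> \<bar>Z s \<omega> - Z t \<omega>\<bar>}) \<longlongrightarrow> 0) (at t within {0..})) \<and>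
     (\<forall>\<omega>\<in>space M. cadlag_on {0..} (\<lambda>t. Z t \<omega>))"

definition increment :: "(real \<Rightarrow> 'a \<Rightarrow> real) \<Rightarrow> real \<Rightarrow> real \<Rightarrow> 'a \<Rightarrow> path" where
  "increment Z x l \<omega> = (\<lambda>s. if s \<in> {0..1} then (Z (x + s * l) \<omega> - Z x \<omega>) / l else 0)"

definition increment_law :: "'a measure \<Rightarrow> (real \<Rightarrow> 'a \<Rightarrow> real) \<Rightarrow> real \<Rightarrow> path measure" where
  "increment_law M Z l = distr M (borel_of skorokhod_topology) (increment Z 0 l)"

definition window :: "real \<Rightarrow> nat \<Rightarrow> nat" where
  "window c n = nat \<lfloor>c * ln (real n)\<rfloor>"

definition increments :: "(real \<Rightarrow> 'a \<Rightarrow> real) \<Rightarrow> real \<Rightarrow> nat \<Rightarrow> 'a \<Rightarrow> path set" where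
  "increments Z c n \<omega> =
     (\<lambda>x. increment Z x (window c n) \<omega>) ` {0..real n - real (window c n)}"

definition increments_nat :: "(real \<Rightarrow> 'a \<Rightarrow> real) \<Rightarrow> real \<Rightarrow> nat \<Rightarrow> 'a \<Rightarrow> path set" where
  "increments_nat Z c n \<omega> =
     (\<lambda>x. increment Z x (window c n) \<omega>) ` ({0..real n - real (window c n)} \<inter> \<nat>)"


section \<open>Functional Erd\H{o}s-R\'enyi laws\<close>

definition negligible_sets :: "'a measure \<Rightarrow> 'a set set" where
  "negligible_sets M = {A. A \<subseteq> space M \<and> (\<exists>B\<in>null_sets M. A \<subseteq> B)}"

definition conegligible_sets :: "'a measure \<Rightarrow> 'a set set" where
  "conegligible_sets M = {space M - A | A. A \<in> negligible_sets M}"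

text \<open>
  The condition \<open>1 \<le> window c n \<le> n\<close> fails for only finitely many \<open>n\<close>, which do not influence
  the following two events.
\<close>

definition ultimately_event :: "(nat \<Rightarrow> 'a set) \<Rightarrow> 'a set" where
  "ultimately_event A = (\<Union>n\<in>{1<..}. \<Inter>k\<in>{n..}. A k)"

definition infinitely_often_event :: "(nat \<Rightarrow> 'a set) \<Rightarrow> 'a set" where
  "infinitely_often_event A = (\<Inter>n\<in>{1<..}. \<Union>k\<in>{n..}. A k)"

definition enlargement :: "'b set \<Rightarrow> ('b \<Rightarrow> 'b \<Rightarrow> real) \<Rightarrow> 'b set \<Rightarrow> real \<Rightarrow> 'b set" where
  "enlargement E d K \<epsilon> = {f \<in> E. \<exists>g\<in>K. d f g < \<epsilon>}"

definition FERL ::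
    "'a measure \<Rightarrow> path set \<Rightarrow> (path \<Rightarrow> path \<Rightarrow> real) \<Rightarrow> (nat \<Rightarrow> 'a \<Rightarrow> path set) \<Rightarrow> path set \<Rightarrow> bool"
  where
  "FERL M E d L K \<longleftrightarrow>
     K \<subseteq> E \<and>
     (\<forall>\<epsilon>>0.
        ultimately_event (\<lambda>n. {\<omega> \<in> space M. L n \<omega> \<subseteq> enlargement E d K \<epsilon>}) \<in> conegligible_sets M \<and>
        ultimately_event (\<lambda>n. {\<omega> \<in> space M. K \<subseteq> enlargement E d (L n \<omega>) \<epsilon>}) \<in> conegligible_sets M)"

definition Delta_event ::
    "'a measure \<Rightarrow> (real \<Rightarrow> 'a \<Rightarrow> real) \<Rightarrow> real \<Rightarrow> (path \<Rightarrow> path \<Rightarrow> real) \<Rightarrow> nat \<Rightarrow> real \<Rightarrow> 'a set" where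
  "Delta_event M Z c d n \<epsilon> =
     {\<omega> \<in> space M. \<exists>x\<in>{0..real n - real (window c n)}.
        d (increment Z x (window c n) \<omega>)
          (increment Z (of_int \<lfloor>x\<rfloor>) (window c n) \<omega>) \<ge> \<epsilon>}"

definition Delta_condition ::
    "'a measure \<Rightarrow> (real \<Rightarrow> 'a \<Rightarrow> real) \<Rightarrow> real \<Rightarrow> (path \<Rightarrow> path \<Rightarrow> real) \<Rightarrow> bool" where
  "Delta_condition M Z c d \<longleftrightarrow>
     (\<forall>\<epsilon>>0. infinitely_often_event (\<lambda>n. Delta_event M Z c d n \<epsilon>) \<in> negligible_sets M)"

text \<open>
  Compatibility of the distance with the linear structure, along the rays from the null function
  and only at the points of \<open>K\<close>.  It holds whenever scalar multiplication is continuous for \<open>d\<close>.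
  Without any link between \<open>d\<close> and the linear operations the functional law can fail: for a
  centred Poisson process, relabelling countably many paths of equal rate preserves large
  deviations and convexity but can make a limit point of maximal rate isolated.
\<close>

definition ray_continuous :: "(path \<Rightarrow> path \<Rightarrow> real) \<Rightarrow> path set \<Rightarrow> bool" where
  "ray_continuous d K \<longleftrightarrow> (\<forall>f\<in>K. ((\<lambda>u. d (\<lambda>s. u * f s) f) \<longlongrightarrow> 0) (at_left 1))"

end

theory Submission
  imports Defs
begin

text \<open>
  The Skorokhod Borel sets are generated by the values at dyadic times, so the increment functions
  inherit stationarity and, over disjoint windows, independence from the finite-dimensional laws.

  Outside a \<open>\<delta>\<close>-open neighbourhood of the compact set \<open>\<K>\<^bsub>1/c\<^esub>\<close> the rate exceeds some \<open>b > 1 / c\<close>, so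
  among the about \<open>exp (a / c)\<close> integer starting points with window \<open>a\<close> the probability of
  a bad one is summable in \<open>a\<close>.  Conversely each \<open>g\<close> in \<open>\<K>\<^bsub>1/c\<^esub>\<close> is a limit of paths \<open>u g\<close> of rate
  below \<open>1 / c\<close>, and the \<open>exp (a / c) / a\<close> independent disjoint windows miss a neighbourhood of
  \<open>u g\<close> with summable probability; total boundedness makes this uniform in \<open>g\<close>.
\<close>

text \<open>The obstacle is that two notions of closeness have to meet. The large deviations
  principle speaks about sets that are open or closed in \<open>T\<close>, the law speaks about
  \<open>d\<close>, and balls of \<open>d\<close> need not be open in \<open>T\<close>. The distance
  \<delta> of (A4) is the bridge: its balls are open in \<open>T\<close>, hence Skorokhod Borel by
  (A1), and around each point of a compact subset of \<open>E' (1 / c)\<close> a small one fits into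
  a given ball of \<open>d\<close>. Compactness of the limit set for \<open>d\<close> comes from
  (A3). The covering half needs a strict exponential surplus, so paths of rate exactly
  \<open>1 / c\<close> are reached only through approximants; this is where convexity and
  \<open>ray_continuous\<close> enter.\<close>

section \<open>Step approximations of cadlag paths\<close>

text \<open>
  Breakpoints are rounded up to the grid, so that the grid points in \<open>[h a, h b)\<close>, at which
  the path is sampled, lie in \<open>[a, b)\<close>.
\<close>

definition grid_time_change ::
    "path \<Rightarrow> real \<Rightarrow> nat \<Rightarrow> real \<Rightarrow> real \<Rightarrow> (real \<Rightarrow> real) \<Rightarrow> bool" where
  "grid_time_change f e N a b h \<longleftrightarrow>
     continuous_on {a..b} h \<and> strict_mono_on {a..b} h \<and>
     h a = \<lceil>real N * a\<rceil> / real N \<and> h b = \<lceil>real N * b\<rceil> / real N \<and>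
     (\<forall>s\<in>{a..b}. \<bar>h s - s\<bar> \<le> 1 / real N) \<and>
     (\<forall>s\<in>{a..<b}. \<bar>f s - f (\<lfloor>real N * h s\<rfloor> / real N)\<bar> \<le> e)"

text \<open>The endpoint values are prescribed by rounding, so the two maps agree at
  \<open>b\<close> and glue to a continuous increasing one. The oscillation bound is half-open so
  that a jump of the path at \<open>b\<close> concerns the right-hand piece only.\<close>

lemma grid_time_change_trans:
  assumes "grid_time_change f e N a b h" "grid_time_change f e N b c k" "a \<le> b" "b \<le> c"
  shows "grid_time_change f e N a c (\<lambda>s. if s \<le> b then h s else k s)"
proof -
  let ?g = "\<lambda>s. if s \<le> b then h s else k s"
  have hk: "h b = k b" using assms by (simp add: grid_time_change_def)
  have "continuous_on ({a..b} \<union> {b..c}) ?g"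
    by (rule continuous_on_If) (use assms hk in \<open>auto simp: grid_time_change_def\<close>)
  moreover have "{a..b} \<union> {b..c} = {a..c}" using assms by auto
  moreover have "strict_mono_on {a..c} ?g"
  proof (rule strict_mono_onI)
    fix r s assume rs: "r \<in> {a..c}" "s \<in> {a..c}" "r < s"
    have mh: "h r < h s" if "s \<le> b"
      using assms(1) rs that by (auto simp: grid_time_change_def strict_mono_on_def)
    have mk: "k r < k s" if "b \<le> r"
      using assms(2) rs that by (auto simp: grid_time_change_def strict_mono_on_def)
    have "h r \<le> h b" if "r \<le> b"
      using assms(1,3) rs that
      by (intro strict_mono_on_leD[of "{a..b}" h]) (auto simp: grid_time_change_def)
    moreover have "k b < k s" if "b < s"
      using assms(2,4) rs that
      by (intro strict_mono_onD[of "{b..c}" k]) (auto simp: grid_time_change_def)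
    ultimately show "?g r < ?g s" using mh mk rs hk by fastforce
  qed
  moreover have "\<bar>f s - f (\<lfloor>real N * ?g s\<rfloor> / real N)\<bar> \<le> e" if "s \<in> {a..<c}" for s
  proof (cases "s < b")
    case True
    then show ?thesis using assms(1) that by (simp add: grid_time_change_def)
  next
    case False
    then have "?g s = k s" using hk by auto
    then show ?thesis using assms(2) that False by (simp only: grid_time_change_def) auto
  qed
  ultimately show ?thesis
    using assms hk unfolding grid_time_change_def by auto
qed

text \<open>An affine map onto the interval between the rounded endpoints works as soon as
  \<open>N\<close> separates them. The degenerate case a = b is covered because
  \<open>eventually_grid_time_change\<close> splits an interval at a point that may be one of its
  ends; the oscillation bound is then vacuous.\<close>

lemma grid_time_change_affine:
  assumes ab: "a \<le> b" and osc: "\<And>r s. r \<in> {a..<b} \<Longrightarrow> s \<in> {a..<b} \<Longrightarrow> \<bar>f r - f s\<bar> \<le> e"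
  shows "\<forall>\<^sub>F N in sequentially. \<exists>h. grid_time_change f e N a b h"
proof (cases "a = b")
  case True
  have "grid_time_change f e N a b (\<lambda>s. \<lceil>real N * a\<rceil> / real N)" if N: "N > 0" for N
  proof -
    have "\<lceil>real N * a\<rceil> - real N * a \<in> {0..1}" by (auto; linarith)
    then have "(\<lceil>real N * a\<rceil> - real N * a) / N \<in> {0..1 / N}" using N by (auto simp: divide_simps)
    then have "\<bar>\<lceil>real N * a\<rceil> / real N - a\<bar> \<le> 1 / N" using N by (simp add: diff_divide_distrib)
    then show ?thesis unfolding grid_time_change_def using True by (auto simp: strict_mono_on_def)
  qed
  then show ?thesis by (auto intro!: eventually_mono[OF eventually_gt_at_top[of 0]])
next
  case False
  then have ab: "a < b" using ab by simp
  have "\<forall>\<^sub>F N in sequentially. real N > 1 / (b - a)"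
    using filterlim_real_sequentially by (simp add: filterlim_at_top_dense)
  then show ?thesis
  proof eventually_elim
    fix N assume N: "real N > 1 / (b - a)"
    have N0: "real N > 0" using N ab by (smt (verit) divide_pos_pos)
    have gap: "real N * b - real N * a > 1" using N ab by (simp add: field_simps)
    define p where "p = \<lceil>real N * a\<rceil> / real N"
    define q where "q = \<lceil>real N * b\<rceil> / real N"
    define h where "h = (\<lambda>s. p + (s - a) / (b - a) * (q - p))"
    have "\<lceil>real N * a\<rceil> < \<lceil>real N * b\<rceil>" using gap by linarith
    then have pq: "p < q" using N0 by (simp add: p_def q_def divide_strict_right_mono)
    have Np: "real N * p = \<lceil>real N * a\<rceil>" "real N * q = \<lceil>real N * b\<rceil>"
      using N0 by (auto simp: p_def q_def)
    have "real N * a \<le> real N * p" "real N * p \<le> real N * (a + 1 / N)"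
      "real N * b \<le> real N * q" "real N * q \<le> real N * (b + 1 / N)" "real N * (q - 1/N) < real N * b"
      using N0 unfolding distrib_left right_diff_distrib Np by (auto; linarith)+
    then have pb: "a \<le> p" "p \<le> a + 1 / N" "b \<le> q" "q \<le> b + 1 / N" "q - 1 / N < b"
      using N0 by (simp_all only: mult_le_cancel_left_pos mult_less_cancel_left_pos)
    have hN: "\<bar>h s - s\<bar> \<le> 1 / real N" if s: "s \<in> {a..b}" for s
    proof -
      \<comment> \<open>Barycentric coordinate of \<open>s\<close>: the displacement of an affine
        map is the convex combination of its displacements at the ends, which lie between 0 and 1 /
        N.\<close>
      define v where "v = (s - a) / (b - a)"
      have v: "0 \<le> v" "v \<le> 1" using s ab by (auto simp: v_def divide_simps)
      have "s = (1 - v) * a + v * b" using ab by (simp add: v_def divide_simps) algebra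
      moreover have "h s = p + v * (q - p)" by (simp only: h_def v_def)
      ultimately have eq: "h s - s = (1 - v) * (p - a) + v * (q - b)"
        by (simp only:) (simp add: algebra_simps)
      have "(1 - v) * (p - a) + v * (q - b) \<le> (1 - v) * (1 / N) + v * (1 / N)"
        by (intro add_mono mult_left_mono) (use pb v in auto)
      moreover have "0 \<le> (1 - v) * (p - a) + v * (q - b)"
        using pb v by auto
      moreover have "(1 - v) * (1 / real N) + v * (1 / N) = 1 / N"
        by (simp add: distrib_right[symmetric] del: times_divide_eq_right)
      ultimately show ?thesis using eq by linarith
    qed
    have hf: "\<bar>f s - f (\<lfloor>real N * h s\<rfloor> / real N)\<bar> \<le> e" if s: "s \<in> {a..<b}" for s
    proof (rule osc[OF s])
      have v: "0 \<le> (s - a) / (b - a)" "(s - a) / (b - a) < 1" using s ab by (auto simp: divide_simps)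
      have "0 \<le> (s - a) / (b - a) * (q - p)" using v pq by (intro mult_nonneg_nonneg) auto
      then have h: "p \<le> h s" by (simp add: h_def)
      have "(s - a) / (b - a) * (q - p) < 1 * (q - p)" using v pq by (intro mult_strict_right_mono) auto
      then have h2: "h s < q" by (simp add: h_def)
      have "real N * p \<le> real N * h s" "real N * h s < real N * q" using h h2 N0 by auto
      \<comment> \<open>Strictness of h s < q gains one grid cell: the sampled point is at most q -
        1 / N, which is below \<open>b\<close>.\<close>
      then have "\<lceil>real N * a\<rceil> \<le> \<lfloor>real N * h s\<rfloor>" "\<lfloor>real N * h s\<rfloor> \<le> \<lceil>real N * b\<rceil> - 1"
        unfolding Np by linarith+
      then have "real_of_int \<lceil>real N * a\<rceil> \<le> \<lfloor>real N * h s\<rfloor>" "\<lfloor>real N * h s\<rfloor> \<le> real_of_int \<lceil>real N * b\<rceil> - 1"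
        by linarith+
      then have "p \<le> \<lfloor>real N * h s\<rfloor> / real N" "\<lfloor>real N * h s\<rfloor> / real N \<le> q - 1 / N"
        using N0 unfolding p_def q_def diff_divide_distrib[symmetric] by (auto intro: divide_right_mono)
      then show "\<lfloor>real N * h s\<rfloor> / real N \<in> {a..<b}" using pb by auto
    qed
    have "strict_mono_on {a..b} h"
      by (rule strict_mono_onI) (use pq ab in \<open>auto simp: h_def divide_strict_right_mono\<close>)
    moreover have "continuous_on {a..b} h"
      using ab unfolding h_def by (intro continuous_intros) auto
    moreover have "h a = p" "h b = q" using ab by (auto simp: h_def)
    ultimately show "\<exists>h. grid_time_change f e N a b h"
      using hN hf unfolding grid_time_change_def p_def q_def by blast
  qed
qed

text \<open>Bisection in the form of \<open>Bolzano\<close>: the existence of a time change passes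
  to unions of adjacent intervals, and near a point the one-sided limits make the path oscillate by
  less than \<open>e\<close> on each side, so the affine map serves left and right of it.\<close>

lemma eventually_grid_time_change:
  assumes f: "f \<in> cadlag_paths" and e: "e > 0"
  shows "\<forall>\<^sub>F N in sequentially. \<exists>h. grid_time_change f e N 0 1 h"
proof -
  \<comment> \<open>The guards \<open>0 \<le> a\<close> and \<open>b \<le> 1\<close> are part of
    \<open>P\<close> because \<open>Bolzano\<close> tests all small intervals around a point,
    including those that leave [0,1], where the cadlag property says nothing.\<close>
  define P where "P a b \<longleftrightarrow> (0 \<le> a \<longrightarrow> b \<le> 1 \<longrightarrow>
    (\<forall>\<^sub>F N in sequentially. \<exists>h. grid_time_change f e N a b h))" for a b :: real
  have tr: "P a c" if "P a b" "P b c" "a \<le> b" "b \<le> c" for a b c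
    unfolding P_def
  proof (intro impI)
    assume "0 \<le> a" "c \<le> 1"
    then have "\<forall>\<^sub>F N in sequentially. \<exists>h. grid_time_change f e N a b h"
      "\<forall>\<^sub>F N in sequentially. \<exists>h. grid_time_change f e N b c h"
      using that by (auto simp: P_def)
    then show "\<forall>\<^sub>F N in sequentially. \<exists>h. grid_time_change f e N a c h"
      by eventually_elim (use grid_time_change_trans that in blast)
  qed
  have "P 0 1"
  proof (rule Bolzano)
    show "P a c" if "P a b" "P b c" "a \<le> b" "b \<le> c" for a b c using tr that by blast
  next
    fix x :: real assume "0 \<le> x" "x \<le> 1"
    then have x: "x \<in> {0..1}" by simp
    have r: "(f \<longlongrightarrow> f x) (at x within {0..1} \<inter> {x<..})"
      and "\<exists>l. (f \<longlongrightarrow> l) (at x within {0..1} \<inter> {..<x})"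
      using f x by (simp_all add: cadlag_paths_def cadlag_on_def)
    then obtain l where l: "(f \<longlongrightarrow> l) (at x within {0..1} \<inter> {..<x})"
      by blast
    obtain d1 where d1: "d1 > 0"
        "\<And>s. s \<in> {0..1} \<inter> {x<..} \<Longrightarrow> dist s x < d1 \<Longrightarrow> dist (f s) (f x) < e / 2"
      using tendstoD[OF r, of "e / 2"] e unfolding eventually_at by auto
    obtain d2 where d2: "d2 > 0"
        "\<And>s. s \<in> {0..1} \<inter> {..<x} \<Longrightarrow> dist s x < d2 \<Longrightarrow> dist (f s) l < e / 2"
      using tendstoD[OF l, of "e / 2"] e unfolding eventually_at by auto
    show "\<exists>d>0. \<forall>a b. a \<le> x \<and> x \<le> b \<and> b - a < d \<longrightarrow> P a b"
    proof (intro exI[of _ "min d1 d2"] conjI allI impI)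
      show "0 < min d1 d2" using d1 d2 by simp
      fix a b assume ab: "a \<le> x \<and> x \<le> b \<and> b - a < min d1 d2"
      have "P a x" unfolding P_def
      proof (intro impI grid_time_change_affine)
        assume a0: "0 \<le> a" "x \<le> 1"
        have *: "\<bar>f s - l\<bar> < e / 2" if "s \<in> {a..<x}" for s
          using d2(2)[of s] that a0 ab by (auto simp: dist_real_def)
        show "\<bar>f r - f s\<bar> \<le> e" if "r \<in> {a..<x}" "s \<in> {a..<x}" for r s
          using *[OF that(1)] *[OF that(2)] by argo
      qed (use ab in auto)
      moreover have "P x b" unfolding P_def
      proof (intro impI grid_time_change_affine)
        assume a0: "0 \<le> x" "b \<le> 1"
        have *: "\<bar>f s - f x\<bar> < e / 2" if "s \<in> {x..<b}" for s
          using d1(2)[of s] that a0 ab e by (cases "s = x") (auto simp: dist_real_def)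
        show "\<bar>f r - f s\<bar> \<le> e" if "r \<in> {x..<b}" "s \<in> {x..<b}" for r s
          using *[OF that(1)] *[OF that(2)] by argo
      qed (use ab in auto)
      ultimately show "P a b" using tr ab by blast
    qed
  qed simp
  then show ?thesis by (simp add: P_def)
qed

section \<open>Sampling and step paths on a uniform grid\<close>

definition grid_path :: "nat \<Rightarrow> (nat \<Rightarrow> real) \<Rightarrow> path" where
  "grid_path N y = (\<lambda>s. if s \<in> {0..1} then y (nat \<lfloor>real N * s\<rfloor>) else 0)"

definition grid_sample :: "nat \<Rightarrow> path \<Rightarrow> nat \<Rightarrow> real" where
  "grid_sample N f = (\<lambda>i. f (real i / real N))"

lemma grid_path_cadlag:
  assumes N: "N > 0"
  shows "grid_path N y \<in> cadlag_paths"
proof -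
  have "(grid_path N y \<longlongrightarrow> grid_path N y t) (at t within {0..1} \<inter> {t<..})" if t: "t \<in> {0..1}" for t
  proof (rule tendsto_eventually)
    have "t < (\<lfloor>real N * t\<rfloor> + 1) / N" using N by (simp add: field_simps) linarith
    then have "\<forall>\<^sub>F s in at t within {0..1} \<inter> {t<..}. s < (\<lfloor>real N * t\<rfloor> + 1) / N"
      by (intro order_tendstoD) (auto intro: tendsto_ident_at)
    moreover have "\<forall>\<^sub>F s in at t within {0..1} \<inter> {t<..}. s \<in> {0..1} \<inter> {t<..}"
      by (auto simp: eventually_at_filter)
    ultimately show "\<forall>\<^sub>F s in at t within {0..1} \<inter> {t<..}. grid_path N y s = grid_path N y t"
    proof eventually_elim
      fix s assume s: "s < (\<lfloor>real N * t\<rfloor> + 1) / N" "s \<in> {0..1} \<inter> {t<..}"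
      have "real N * s < \<lfloor>real N * t\<rfloor> + 1" using s N by (simp add: field_simps)
      moreover have "real N * t \<le> real N * s" using s by (auto intro: mult_left_mono)
      ultimately have "\<lfloor>real N * s\<rfloor> = \<lfloor>real N * t\<rfloor>" by linarith
      then show "grid_path N y s = grid_path N y t" using s t by (simp add: grid_path_def)
    qed
  qed
  moreover have "\<exists>l. (grid_path N y \<longlongrightarrow> l) (at t within {0..1} \<inter> {..<t})" if t: "t \<in> {0..1}" for t
  proof (intro exI tendsto_eventually)
    have "(\<lceil>real N * t\<rceil> - 1) / N < t" using N by (simp add: field_simps) linarith
    then have "\<forall>\<^sub>F s in at t within {0..1} \<inter> {..<t}. (\<lceil>real N * t\<rceil> - 1) / N < s"
      by (intro order_tendstoD) (auto intro: tendsto_ident_at)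
    moreover have "\<forall>\<^sub>F s in at t within {0..1} \<inter> {..<t}. s \<in> {0..1} \<inter> {..<t}"
      by (auto simp: eventually_at_filter)
    \<comment> \<open>At t = 0 the filter is trivial, so the index \<open>nat (- 1)\<close> imposes
      nothing.\<close>
    ultimately show "\<forall>\<^sub>F s in at t within {0..1} \<inter> {..<t}. grid_path N y s = y (nat (\<lceil>real N * t\<rceil> - 1))"
    proof eventually_elim
      fix s assume s: "(\<lceil>real N * t\<rceil> - 1) / N < s" "s \<in> {0..1} \<inter> {..<t}"
      have "\<lceil>real N * t\<rceil> - 1 < real N * s" using s N by (simp add: field_simps)
      moreover have "real N * s < real N * t" using s N by auto
      ultimately have "\<lfloor>real N * s\<rfloor> = \<lceil>real N * t\<rceil> - 1" by linarith
      then show "grid_path N y s = y (nat (\<lceil>real N * t\<rceil> - 1))" using s by (simp add: grid_path_def)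
    qed
  qed
  ultimately show ?thesis
    by (auto simp: cadlag_paths_def cadlag_on_def unit_functions_def grid_path_def)
qed

lemma skorokhod_dist_le_uniform:
  assumes "f \<in> cadlag_paths" "g \<in> cadlag_paths" "\<And>t. t \<in> {0..1} \<Longrightarrow> \<bar>f t - g t\<bar> \<le> r" "r < e" "0 \<le> r"
  shows "skorokhod_dist f g < e"
  unfolding skorokhod_dist_less_iff[OF assms(1,2)]
  using assms(3-) id_time_change by (intro exI[of _ r] conjI bexI[of _ "\<lambda>t. t"]) auto

text \<open>The last clause of \<open>grid_time_change\<close> compares f s with the sample in the
  cell of h s, and that sample is the value of the step path at h s; so the same h is a time change
  of small Skorokhod cost.\<close>

lemma grid_path_sample_converges:
  assumes f: "f \<in> cadlag_paths" and e: "e > 0"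
  shows "\<forall>\<^sub>F N in sequentially. skorokhod_dist f (grid_path N (grid_sample N f)) < e"
proof -
  have "\<forall>\<^sub>F N in sequentially. real N > 2 / e"
    using filterlim_real_sequentially by (simp add: filterlim_at_top_dense)
  moreover have "\<forall>\<^sub>F N in sequentially. \<exists>h. grid_time_change f (e / 2) N 0 1 h"
    using f e by (intro eventually_grid_time_change) auto
  ultimately show ?thesis using eventually_gt_at_top[of 0]
  proof eventually_elim
    fix N :: nat assume N: "real N > 2 / e" "\<exists>h. grid_time_change f (e / 2) N 0 1 h" "0 < N"
    then obtain h where h: "grid_time_change f (e / 2) N 0 1 h" by blast
    have tc: "h \<in> time_changes" using h N(3) by (simp add: grid_time_change_def time_changes_def)
    have N2: "1 / real N < e / 2" using N e by (simp add: field_simps)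
    show "skorokhod_dist f (grid_path N (grid_sample N f)) < e"
      unfolding skorokhod_dist_less_iff[OF f grid_path_cadlag[OF N(3)]]
    proof (intro exI[of _ "e / 2"] conjI bexI[OF _ tc] ballI)
      fix t :: real assume t: "t \<in> {0..1}"
      have "\<bar>h t - t\<bar> \<le> 1 / real N" using h t by (simp add: grid_time_change_def)
      then show "\<bar>h t - t\<bar> \<le> e / 2" using N2 by linarith
      have ht: "h t \<in> {0..1}" by (rule time_change_range[OF tc t])
      then have fl: "real (nat \<lfloor>real N * h t\<rfloor>) = \<lfloor>real N * h t\<rfloor>" by simp
      have g: "grid_path N (grid_sample N f) (h t) = f (\<lfloor>real N * h t\<rfloor> / N)"
        using ht unfolding grid_path_def grid_sample_def fl by auto
      \<comment> \<open>The half-open oscillation bound leaves out t = 1; there h 1 = 1 and both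
        values are f 1.\<close>
      show "\<bar>f t - grid_path N (grid_sample N f) (h t)\<bar> \<le> e / 2"
      proof (cases "t = 1")
        case True
        then have "h t = 1" using tc by (simp add: time_changes_def)
        then show ?thesis using True N(3) e unfolding g by simp
      next
        case False
        then show ?thesis using h t unfolding g by (simp add: grid_time_change_def)
      qed
    qed (use e in auto)
  qed
qed

section \<open>Dyadic cylinders and the Skorokhod Borel sets\<close>

text \<open>Powers of two make the grids nested, so that finitely many cylinders can be written over
  one grid and the class is stable under intersection. Samples with index above 2 ^ n vanish for
  paths on [0,1], so a Borel set of infinite sequences constrains finitely many values only.\<close>

definition dyadic_cylinder :: "nat \<Rightarrow> (nat \<Rightarrow> real) set \<Rightarrow> path set" where
  "dyadic_cylinder n Y = {f \<in> cadlag_paths. grid_sample (2 ^ n) f \<in> Y}"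

definition dyadic_cylinders :: "path set set" where
  "dyadic_cylinders = {dyadic_cylinder n Y | n Y. Y \<in> sets borel}"

lemma dyadic_cylinder_refine:
  assumes "n \<le> m" "Y \<in> sets borel"
  shows "\<exists>Y'\<in>sets borel. dyadic_cylinder n Y = dyadic_cylinder m Y'"
proof (intro bexI[of _ "(\<lambda>y i. y (2 ^ (m - n) * i)) -` Y"])
  have "real i / 2 ^ n = real (2 ^ (m - n) * i) / 2 ^ m" for i
  proof -
    have "(2::real) ^ m = 2 ^ (m - n) * 2 ^ n" using assms(1) by (simp add: power_add[symmetric])
    then show ?thesis by simp
  qed
  then have "grid_sample (2 ^ n) f = (\<lambda>i. grid_sample (2 ^ m) f (2 ^ (m - n) * i))" for f
    by (simp add: grid_sample_def)
  then show "dyadic_cylinder n Y = dyadic_cylinder m ((\<lambda>y i. y (2 ^ (m - n) * i)) -` Y)"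
    by (simp add: dyadic_cylinder_def)
  have "(\<lambda>(y :: nat \<Rightarrow> real) i. y (2 ^ (m - n) * i)) \<in> borel_measurable borel"
    by (intro measurable_coordinatewise_then_product measurable_product_coordinates)
  from measurable_sets[OF this assms(2)]
  show "(\<lambda>(y :: nat \<Rightarrow> real) i. y (2 ^ (m - n) * i)) -` Y \<in> sets borel" by simp
qed

lemma Int_stable_dyadic_cylinders: "Int_stable dyadic_cylinders"
proof (rule Int_stableI)
  fix A B assume "A \<in> dyadic_cylinders" "B \<in> dyadic_cylinders"
  then obtain n Y m X where A: "A = dyadic_cylinder n Y" "Y \<in> sets borel"
    and B: "B = dyadic_cylinder m X" "X \<in> sets borel"
    by (auto simp: dyadic_cylinders_def)
  obtain Y' where Y': "Y' \<in> sets borel" "A = dyadic_cylinder (max n m) Y'"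
    using dyadic_cylinder_refine[OF max.cobounded1 A(2)] unfolding A(1) by metis
  obtain X' where X': "X' \<in> sets borel" "B = dyadic_cylinder (max n m) X'"
    using dyadic_cylinder_refine[OF max.cobounded2 B(2)] unfolding B(1) by metis
  have "A \<inter> B = dyadic_cylinder (max n m) (Y' \<inter> X')"
    unfolding Y' X' dyadic_cylinder_def by blast
  moreover have "Y' \<inter> X' \<in> sets borel" using Y'(1) X'(1) by (rule sets.Int)
  ultimately show "A \<inter> B \<in> dyadic_cylinders"
    unfolding dyadic_cylinders_def by blast
qed

lemma dyadic_cylinders_Pow: "dyadic_cylinders \<subseteq> Pow cadlag_paths"
  by (auto simp: dyadic_cylinders_def dyadic_cylinder_def)

lemma cadlag_paths_in_dyadic_cylinders: "cadlag_paths \<in> dyadic_cylinders"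
proof -
  have "cadlag_paths = dyadic_cylinder 0 UNIV" by (simp add: dyadic_cylinder_def)
  moreover have "UNIV \<in> sets (borel :: (nat \<Rightarrow> real) measure)" by simp
  ultimately show ?thesis unfolding dyadic_cylinders_def by blast
qed

lemma dyadic_path_sample_converges:
  assumes "f \<in> cadlag_paths" "e > 0"
  shows "\<forall>\<^sub>F m in sequentially. skorokhod_dist f (grid_path (2 ^ m) (grid_sample (2 ^ m) f)) < e"
proof -
  have "filterlim (\<lambda>m. 2 ^ m :: nat) at_top sequentially"
    by (rule filterlim_subseq) (auto simp: strict_mono_def)
  from eventually_compose_filterlim[OF grid_path_sample_converges[OF assms] this]
  show ?thesis .
qed

interpretation skorokhod: Metric_space cadlag_paths skorokhod_dist
  by (rule Metric_space_skorokhod)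

text \<open>This makes the sets of sample vectors in \<open>skorokhod_open_in_dyadic_sigma\<close>
  Borel. A step path depends on the coordinates 0 to N only, and moving each of them by at most r
  moves the path by at most r uniformly, without any time change.\<close>

lemma open_grid_path_preimage:
  assumes V: "openin skorokhod_topology V" and N: "N > 0"
  shows "open {y. grid_path N y \<in> V}"
proof (subst open_subopen, intro ballI)
  fix y assume "y \<in> {y. grid_path N y \<in> V}"
  then obtain e where e: "e > 0" "skorokhod.mball (grid_path N y) e \<subseteq> V"
    using V by (auto simp: skorokhod_topology_def skorokhod.openin_mtopology)
  define W where "W = (\<Inter>i\<in>{..N}. (\<lambda>z. z i) -` ball (y i) (e / 2))"
  have "open W" unfolding W_def
    by (intro open_INT ballI open_vimage continuous_on_product_coordinates) auto
  moreover have "y \<in> W" using e by (simp add: W_def)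
  moreover have "grid_path N z \<in> V" if z: "z \<in> W" for z
  proof -
    have "skorokhod_dist (grid_path N y) (grid_path N z) < e"
    proof (rule skorokhod_dist_le_uniform[of _ _ "e / 2"])
      fix t :: real assume t: "t \<in> {0..1}"
      have "real N * t \<le> real N" using t by (simp add: mult_left_le)
      then have "nat \<lfloor>real N * t\<rfloor> \<le> N" by linarith
      then have "dist (y (nat \<lfloor>real N * t\<rfloor>)) (z (nat \<lfloor>real N * t\<rfloor>)) < e / 2"
        using z by (auto simp: W_def)
      then show "\<bar>grid_path N y t - grid_path N z t\<bar> \<le> e / 2"
        using t by (simp add: grid_path_def dist_real_def)
    qed (use e grid_path_cadlag[OF N] in auto)
    then show ?thesis using e grid_path_cadlag[OF N] by auto
  qed
  ultimately show "\<exists>T. open T \<and> y \<in> T \<and> T \<subseteq> {y. grid_path N y \<in> V}" by blast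
qed

text \<open>
  A path lies in an open set iff its dyadic step approximations eventually do so with a
  uniform margin.  This replaces the usual argument by separability of the Skorokhod space.
\<close>

lemma skorokhod_open_in_dyadic_sigma:
  assumes U: "openin skorokhod_topology U"
  shows "U \<in> sigma_sets cadlag_paths dyadic_cylinders"
proof -
  \<comment> \<open>Points whose ball of some radius above 1 / (k + 1) lies in \<open>U\<close>. The
    strict inequality keeps \<open>V k\<close> open, because a slightly shifted point still has more
    margin than that.\<close>
  define V where "V k = {g \<in> cadlag_paths. \<exists>e>1 / real (Suc k). skorokhod.mball g e \<subseteq> U}" for k
  define W where "W m k = {y. grid_path (2 ^ m) y \<in> V k}" for m k
  have V: "openin skorokhod_topology (V k)" for k
    unfolding skorokhod_topology_def skorokhod.openin_mtopology
  proof (intro conjI allI impI)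
    show "V k \<subseteq> cadlag_paths" by (auto simp: V_def)
    fix g assume "g \<in> V k"
    then obtain e where e: "g \<in> cadlag_paths" "e > 1 / real (Suc k)" "skorokhod.mball g e \<subseteq> U"
      unfolding V_def by blast
    obtain r where r: "1 / real (Suc k) < r" "r < e" using dense e(2) by blast
    have "skorokhod.mball g (e - r) \<subseteq> V k"
    proof
      fix h assume h: "h \<in> skorokhod.mball g (e - r)"
      then have "skorokhod.mball h r \<subseteq> skorokhod.mball g e"
        by (intro skorokhod.mball_subset) (auto simp: skorokhod_dist_commute)
      moreover have "h \<in> cadlag_paths" using h by simp
      ultimately show "h \<in> V k" using e(3) r(1) unfolding V_def by blast
    qed
    then show "\<exists>r>0. skorokhod.mball g r \<subseteq> V k" using r by (intro exI[of _ "e - r"]) auto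
  qed
  have "U = (\<Union>k. \<Union>M. \<Inter>m\<in>{M..}. dyadic_cylinder m (W m k))"
  proof (intro set_eqI iffI)
    fix f assume fU: "f \<in> U"
    then obtain e where e: "f \<in> cadlag_paths" "e > 0" "skorokhod.mball f e \<subseteq> U"
      using U unfolding skorokhod_topology_def skorokhod.openin_mtopology by blast
    obtain k where k: "1 / real (Suc k) < e / 2"
      using nat_approx_posE[of "e / 2"] e by auto
    have "\<forall>\<^sub>F m in sequentially.
        skorokhod_dist f (grid_path (2 ^ m) (grid_sample (2 ^ m) f)) < e / 2"
      using e by (intro dyadic_path_sample_converges) auto
    then obtain M where M: "\<And>m. m \<ge> M \<Longrightarrow>
        skorokhod_dist f (grid_path (2 ^ m) (grid_sample (2 ^ m) f)) < e / 2"
      unfolding eventually_sequentially by blast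
    have "grid_sample (2 ^ m) f \<in> W m k" if "m \<ge> M" for m
    proof -
      let ?g = "grid_path (2 ^ m) (grid_sample (2 ^ m) f)"
      have g: "?g \<in> cadlag_paths" by (simp add: grid_path_cadlag)
      have "skorokhod.mball ?g (e / 2) \<subseteq> skorokhod.mball f e"
        using M[OF that] g e by (intro skorokhod.mball_subset) (auto simp: skorokhod_dist_commute)
      then have "?g \<in> V k" using k e(3) g unfolding V_def by blast
      then show ?thesis by (simp add: W_def)
    qed
    then show "f \<in> (\<Union>k. \<Union>M. \<Inter>m\<in>{M..}. dyadic_cylinder m (W m k))"
      using e by (auto simp: dyadic_cylinder_def)
  next
    fix f assume "f \<in> (\<Union>k. \<Union>M. \<Inter>m\<in>{M..}. dyadic_cylinder m (W m k))"
    then obtain k M where M: "\<And>m. m \<ge> M \<Longrightarrow> f \<in> dyadic_cylinder m (W m k)" by auto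
    have f: "f \<in> cadlag_paths" using M[of M] by (simp add: dyadic_cylinder_def)
    have "\<forall>\<^sub>F m in sequentially.
        skorokhod_dist f (grid_path (2 ^ m) (grid_sample (2 ^ m) f)) < 1 / real (Suc k)"
      using f by (intro dyadic_path_sample_converges) auto
    then have "\<forall>\<^sub>F m in sequentially. m \<ge> M \<and>
        skorokhod_dist f (grid_path (2 ^ m) (grid_sample (2 ^ m) f)) < 1 / real (Suc k)"
      using eventually_ge_at_top[of M] by eventually_elim auto
    then obtain m where m: "m \<ge> M"
        "skorokhod_dist f (grid_path (2 ^ m) (grid_sample (2 ^ m) f)) < 1 / real (Suc k)"
      using eventually_happens'[OF sequentially_bot] by blast
    have "grid_path (2 ^ m) (grid_sample (2 ^ m) f) \<in> V k"
      using M[OF m(1)] by (simp add: dyadic_cylinder_def W_def)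
    \<comment> \<open>The margin exceeds the distance from \<open>f\<close> to its step
      approximation, so \<open>f\<close> itself is in \<open>U\<close>.\<close>
    then obtain e where e: "e > 1 / real (Suc k)"
        "skorokhod.mball (grid_path (2 ^ m) (grid_sample (2 ^ m) f)) e \<subseteq> U"
      unfolding V_def by blast
    have "f \<in> skorokhod.mball (grid_path (2 ^ m) (grid_sample (2 ^ m) f)) e"
      using m(2) e(1) f grid_path_cadlag[of "2 ^ m"] by (auto simp: skorokhod_dist_commute)
    then show "f \<in> U" using e(2) by blast
  qed
  moreover have "(\<Union>k. \<Union>M. \<Inter>m\<in>{M..}. dyadic_cylinder m (W m k))
      \<in> sigma_sets cadlag_paths dyadic_cylinders"
  proof -
    interpret sigma_algebra cadlag_paths "sigma_sets cadlag_paths dyadic_cylinders"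
      by (rule sigma_algebra_sigma_sets) (rule dyadic_cylinders_Pow)
    have "W m k \<in> sets borel" for m k
      unfolding W_def by (intro borel_open open_grid_path_preimage V) simp
    then have "dyadic_cylinder m (W m k) \<in> sigma_sets cadlag_paths dyadic_cylinders" for m k
      by (intro sigma_sets.Basic) (auto simp: dyadic_cylinders_def)
    then show ?thesis
      by (intro countable_UN countable_INT') auto
  qed
  ultimately show ?thesis by simp
qed

lemma topspace_skorokhod [simp]: "topspace skorokhod_topology = cadlag_paths"
  by (simp add: skorokhod_topology_def)

lemma space_borel_of [simp]: "space (borel_of T) = topspace T"
  by (simp add: borel_of_def space_measure_of_conv)

lemma sets_borel_of: "sets (borel_of T) = sigma_sets (topspace T) {U. openin T U}"
  unfolding borel_of_def by (rule sets_measure_of) (auto dest: openin_subset)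

definition dyadic_algebra :: "path measure" where
  "dyadic_algebra = sigma cadlag_paths dyadic_cylinders"

lemma sets_dyadic_algebra: "sets dyadic_algebra = sigma_sets cadlag_paths dyadic_cylinders"
  and space_dyadic_algebra [simp]: "space dyadic_algebra = cadlag_paths"
  by (simp_all add: dyadic_algebra_def dyadic_cylinders_Pow)

text \<open>Laws are compared on cylinders, which generate \<open>dyadic_algebra\<close>; through
  this inclusion the comparison reaches every Skorokhod Borel set.\<close>

lemma skorokhod_borel_le_dyadic: "sets (borel_of skorokhod_topology) \<subseteq> sets dyadic_algebra"
  unfolding sets_borel_of sets_dyadic_algebra topspace_skorokhod
  by (intro sigma_sets_mono) (auto intro: skorokhod_open_in_dyadic_sigma)

section \<open>Stationarity and independence of increment functions\<close>

lemma levy_processD: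
  assumes "levy_process M Z"
  shows "prob_space M"
    and "\<And>t. 0 \<le> t \<Longrightarrow> Z t \<in> borel_measurable M"
    and "\<And>s h. 0 \<le> s \<Longrightarrow> 0 \<le> h \<Longrightarrow> distr M borel (\<lambda>\<omega>. Z (s + h) \<omega> - Z s \<omega>) =
      distr M borel (\<lambda>\<omega>. Z h \<omega> - Z 0 \<omega>)"
    and "\<And>(n::nat) t. 0 \<le> t 0 \<Longrightarrow> (\<And>i. i < n \<Longrightarrow> t i \<le> t (Suc i)) \<Longrightarrow>
      prob_space.indep_vars M (\<lambda>_. borel) (\<lambda>i \<omega>. Z (t (Suc i)) \<omega> - Z (t i) \<omega>) {..<n}"
    and "\<And>\<omega>. \<omega> \<in> space M \<Longrightarrow> cadlag_on {0..} (\<lambda>t. Z t \<omega>)"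
  using assms unfolding levy_process_def by blast+

text \<open>The substitution u = x + s l is increasing as l > 0, so it preserves the side from which
  a limit is taken.\<close>

lemma increment_cadlag:
  assumes Z: "levy_process M Z" and x: "0 \<le> x" and l: "0 < l" and \<omega>: "\<omega> \<in> space M"
  shows "increment Z x l \<omega> \<in> cadlag_paths"
proof -
  \<comment> \<open>The sets \<open>A\<close> and \<open>B\<close> are left free so that one
    argument covers right and left limits.\<close>
  have lim: "(increment Z x l \<omega> \<longlongrightarrow> (b - Z x \<omega>) / l) (at t within {0..1} \<inter> A)"
    if B: "((\<lambda>u. Z u \<omega>) \<longlongrightarrow> b) (at (x + t * l) within {0..} \<inter> B)"
      and AB: "\<And>s. s \<in> A \<Longrightarrow> x + s * l \<in> B" for b t A B
  proof (rule Lim_transform_eventually)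
    have "filterlim (\<lambda>s. x + s * l) (at (x + t * l) within {0..} \<inter> B) (at t within {0..1} \<inter> A)"
      using x l AB unfolding filterlim_at
      by (auto intro!: tendsto_intros simp: eventually_at_filter)
    from filterlim_compose[OF B this]
    have "((\<lambda>s. Z (x + s * l) \<omega>) \<longlongrightarrow> b) (at t within {0..1} \<inter> A)" .
    then show "((\<lambda>s. (Z (x + s * l) \<omega> - Z x \<omega>) / l) \<longlongrightarrow> (b - Z x \<omega>) / l) (at t within {0..1} \<inter> A)"
      using l by (intro tendsto_intros) auto
    show "\<forall>\<^sub>F s in at t within {0..1} \<inter> A. (Z (x + s * l) \<omega> - Z x \<omega>) / l = increment Z x l \<omega> s"
      by (auto simp: eventually_at_filter increment_def)
  qed
  have cad: "cadlag_on {0..} (\<lambda>t. Z t \<omega>)" using levy_processD(5)[OF Z \<omega>] .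
  have "(increment Z x l \<omega> \<longlongrightarrow> increment Z x l \<omega> t) (at t within {0..1} \<inter> {t<..}) \<and>
    (\<exists>b. (increment Z x l \<omega> \<longlongrightarrow> b) (at t within {0..1} \<inter> {..<t}))" if t: "t \<in> {0..1}" for t
  proof
    have u: "x + t * l \<in> {0..}" using x l t by simp
    have "((\<lambda>u. Z u \<omega>) \<longlongrightarrow> Z (x + t * l) \<omega>) (at (x + t * l) within {0..} \<inter> {x + t * l<..})"
      using cad u unfolding cadlag_on_def by blast
    from lim[OF this, of "{t<..}"] l
    show "(increment Z x l \<omega> \<longlongrightarrow> increment Z x l \<omega> t) (at t within {0..1} \<inter> {t<..})"
      using t by (auto simp: increment_def)
    obtain b where "((\<lambda>u. Z u \<omega>) \<longlongrightarrow> b) (at (x + t * l) within {0..} \<inter> {..<x + t * l})"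
      using cad u unfolding cadlag_on_def by blast
    from lim[OF this, of "{..<t}"] l
    show "\<exists>b. (increment Z x l \<omega> \<longlongrightarrow> b) (at t within {0..1} \<inter> {..<t})"
      by auto
  qed
  then show ?thesis
    by (auto simp: cadlag_paths_def cadlag_on_def unit_functions_def increment_def)
qed

lemma grid_sample_increment_measurable:
  assumes Z: "levy_process M Z" and x: "0 \<le> x" and l: "0 < l"
  shows "(\<lambda>\<omega>. grid_sample N (increment Z x l \<omega>)) \<in> borel_measurable M"
proof (rule measurable_coordinatewise_then_product)
  fix i
  have "Z x \<in> borel_measurable M" "Z (x + real i / real N * l) \<in> borel_measurable M"
    using levy_processD(2)[OF Z] x l by auto
  then show "(\<lambda>\<omega>. grid_sample N (increment Z x l \<omega>) i) \<in> borel_measurable M"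
    unfolding grid_sample_def increment_def by measurable
qed

lemma increment_measurable_dyadic:
  assumes Z: "levy_process M Z" and x: "0 \<le> x" and l: "0 < l"
  shows "increment Z x l \<in> measurable M dyadic_algebra"
  unfolding dyadic_algebra_def
proof (rule measurable_measure_of[OF dyadic_cylinders_Pow])
  show "increment Z x l \<in> space M \<rightarrow> cadlag_paths" using increment_cadlag[OF assms] by blast
  fix A assume "A \<in> dyadic_cylinders"
  then obtain n Y where A: "A = dyadic_cylinder n Y" "Y \<in> sets borel"
    unfolding dyadic_cylinders_def by blast
  have "increment Z x l -` A \<inter> space M = (\<lambda>\<omega>. grid_sample (2 ^ n) (increment Z x l \<omega>)) -` Y \<inter> space M"
    using increment_cadlag[OF assms] unfolding A(1) dyadic_cylinder_def by blast
  then show "increment Z x l -` A \<inter> space M \<in> sets M"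
    using measurable_sets[OF grid_sample_increment_measurable[OF assms] A(2)] by simp
qed

lemma increment_measurable_skorokhod:
  assumes Z: "levy_process M Z" and x: "0 \<le> x" and l: "0 < l"
  shows "increment Z x l \<in> measurable M (borel_of skorokhod_topology)"
proof (rule measurableI)
  show "increment Z x l \<omega> \<in> space (borel_of skorokhod_topology)" if "\<omega> \<in> space M" for \<omega>
    using increment_cadlag[OF assms that] by simp
  show "increment Z x l -` A \<inter> space M \<in> sets M" if "A \<in> sets (borel_of skorokhod_topology)" for A
    using measurable_sets[OF increment_measurable_dyadic[OF assms]] skorokhod_borel_le_dyadic that
    by blast
qed

section \<open>Increment functions as sums of independent steps\<close>

definition levy_step :: "(real \<Rightarrow> 'a \<Rightarrow> real) \<Rightarrow> real \<Rightarrow> real \<Rightarrow> nat \<Rightarrow> 'a \<Rightarrow> real" where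
  "levy_step Z x h r \<omega> = Z (x + real (Suc r) * h) \<omega> - Z (x + real r * h) \<omega>"

text \<open>Rescaled partial sums over the block of steps that makes up window \<open>j\<close>. The
  value 0 beyond 2 ^ n matches the convention that paths vanish outside [0,1].\<close>

definition step_sample :: "nat \<Rightarrow> real \<Rightarrow> nat \<Rightarrow> (nat \<Rightarrow> real) \<Rightarrow> nat \<Rightarrow> real" where
  "step_sample n l j y = (\<lambda>i. if i \<le> 2 ^ n then (\<Sum>r<i. y (j * 2 ^ n + r)) / l else 0)"

definition step_block :: "nat \<Rightarrow> nat \<Rightarrow> nat set" where
  "step_block n j = {j * 2 ^ n..<Suc j * 2 ^ n}"

text \<open>Telescoping. Restricting the steps to \<open>step_block n j\<close> exhibits the samples
  of window \<open>j\<close> as a function of that block alone, the form in which independence of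
  disjoint blocks is available.\<close>

lemma grid_sample_increment:
  "grid_sample (2 ^ n) (increment Z (x + real j * l) l \<omega>) =
     step_sample n l j (\<lambda>r\<in>step_block n j. levy_step Z x (l / 2 ^ n) r \<omega>)"
proof
  fix i
  have *: "x + real (j * 2 ^ n + i) * (l / 2 ^ n) = x + real j * l + real i / 2 ^ n * l" for i
    by (simp add: field_simps)
  show "grid_sample (2 ^ n) (increment Z (x + real j * l) l \<omega>) i =
     step_sample n l j (\<lambda>r\<in>step_block n j. levy_step Z x (l / 2 ^ n) r \<omega>) i"
  proof (cases "i \<le> 2 ^ n")
    case True
    then have i: "real i / 2 ^ n \<in> {0..1}" by simp
    have "(\<Sum>r<i. (\<lambda>r\<in>step_block n j. levy_step Z x (l / 2 ^ n) r \<omega>) (j * 2 ^ n + r)) =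
        (\<Sum>r<i. Z (x + real (j * 2 ^ n + Suc r) * (l / 2 ^ n)) \<omega> -
          Z (x + real (j * 2 ^ n + r) * (l / 2 ^ n)) \<omega>)"
      using True by (intro sum.cong) (auto simp: step_block_def levy_step_def)
    also have "\<dots> = Z (x + real (j * 2 ^ n + i) * (l / 2 ^ n)) \<omega> - Z (x + real (j * 2 ^ n + 0) * (l / 2 ^ n)) \<omega>"
      by (rule sum_lessThan_telescope)
    also have "\<dots> = Z (x + real j * l + real i / 2 ^ n * l) \<omega> - Z (x + real j * l) \<omega>"
      unfolding * by simp
    finally show ?thesis
      using True i by (simp add: grid_sample_def increment_def step_sample_def)
  next
    case False
    then have "2 ^ n < i" by simp
    then have "real (2 ^ n) < real i" using of_nat_less_iff by blast
    then have "\<not> real i / 2 ^ n \<le> 1" by (simp add: field_simps)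
    then show ?thesis
      using False by (simp add: grid_sample_def increment_def step_sample_def)
  qed
qed

lemma step_sample_measurable:
  assumes "step_block n j \<subseteq> K"
  shows "step_sample n l j \<in> borel_measurable (PiM K (\<lambda>_. borel))"
proof (rule measurable_coordinatewise_then_product)
  fix i
  have "(\<lambda>y :: nat \<Rightarrow> real. \<Sum>r<i. y (j * 2 ^ n + r)) \<in> borel_measurable (PiM K (\<lambda>_. borel))" if "i \<le> 2 ^ n"
  proof (rule borel_measurable_sum)
    fix r assume "r \<in> {..<i}"
    then have "j * 2 ^ n + r \<in> K" using that assms by (auto simp: step_block_def)
    then show "(\<lambda>y :: nat \<Rightarrow> real. y (j * 2 ^ n + r)) \<in> borel_measurable (PiM K (\<lambda>_. borel))"
      by (rule measurable_component_singleton)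
  qed
  then show "(\<lambda>y. step_sample n l j y i) \<in> borel_measurable (PiM K (\<lambda>_. borel))"
    unfolding step_sample_def by (cases "i \<le> 2 ^ n") simp_all
qed

lemma levy_step_measurable:
  assumes "levy_process M Z" "0 \<le> x" "0 \<le> h"
  shows "levy_step Z x h r \<in> borel_measurable M"
  unfolding levy_step_def using assms(2,3)
  by (intro borel_measurable_diff levy_processD(2)[OF assms(1)]) auto

lemma levy_step_indep:
  assumes "levy_process M Z" "0 \<le> x" "0 \<le> h"
  shows "prob_space.indep_vars M (\<lambda>_. borel) (levy_step Z x h) {..<k}"
  unfolding levy_step_def[abs_def] using assms(2,3)
  by (intro levy_processD(4)[OF assms(1), of "\<lambda>r. x + real r * h"]) (auto intro: mult_right_mono)

lemma levy_step_law:
  assumes "levy_process M Z" "0 \<le> x" "0 \<le> h"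
  shows "distr M borel (levy_step Z x h r) = distr M borel (\<lambda>\<omega>. Z h \<omega> - Z 0 \<omega>)"
  using levy_processD(3)[OF assms(1), of "x + real r * h" h] assms(2,3)
  unfolding levy_step_def[abs_def] by (simp add: algebra_simps)

text \<open>Independence makes the joint law a product and stationarity makes all factors equal; the
  right-hand side no longer mentions \<open>x\<close>.\<close>

lemma levy_step_vector_law:
  assumes Z: "levy_process M Z" and x: "0 \<le> x" and h: "0 \<le> h" and k: "0 < k"
  shows "distr M (PiM {..<k} (\<lambda>_. borel)) (\<lambda>\<omega>. \<lambda>r\<in>{..<k}. levy_step Z x h r \<omega>) =
    PiM {..<k} (\<lambda>_. distr M borel (\<lambda>\<omega>. Z h \<omega> - Z 0 \<omega>))"
proof -
  interpret prob_space M by (rule levy_processD(1)[OF Z])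
  have "{..<k} \<noteq> {}" using k by auto
  from indep_vars_iff_distr_eq_PiM[OF this, where M' = "\<lambda>_. borel" and X = "levy_step Z x h"]
  show ?thesis
    using levy_step_measurable[OF Z x h] levy_step_indep[OF Z x h]
    by (simp add: levy_step_law[OF Z x h])
qed

text \<open>At each dyadic level the samples are a fixed function of a step vector whose law is free
  of \<open>x\<close>. Uniqueness of finite measures on an intersection-stable generator extends the
  equality from cylinders to \<open>dyadic_algebra\<close>.\<close>

lemma increment_law_stationary:
  assumes Z: "levy_process M Z" and x: "0 \<le> x" and l: "0 < l"
  shows "distr M dyadic_algebra (increment Z x l) = distr M dyadic_algebra (increment Z 0 l)"
proof -
  interpret prob_space M by (rule levy_processD(1)[OF Z])
  have samp: "distr M borel (\<lambda>\<omega>. grid_sample (2 ^ n) (increment Z x l \<omega>)) =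
      distr (PiM {..<2 ^ n} (\<lambda>_. distr M borel (\<lambda>\<omega>. Z (l / 2 ^ n) \<omega> - Z 0 \<omega>))) borel (step_sample n l 0)"
    if x: "0 \<le> x" for x n
  proof -
    have b: "step_block n 0 = {..<2 ^ n}" by (auto simp: step_block_def)
    have m: "(\<lambda>\<omega>. \<lambda>r\<in>{..<2 ^ n}. levy_step Z x (l / 2 ^ n) r \<omega>) \<in> measurable M (PiM {..<2 ^ n} (\<lambda>_. borel))"
      using levy_step_measurable[OF Z x] l by (intro measurable_restrict) auto
    have "distr M borel (\<lambda>\<omega>. grid_sample (2 ^ n) (increment Z x l \<omega>)) =
        distr (distr M (PiM {..<2 ^ n} (\<lambda>_. borel)) (\<lambda>\<omega>. \<lambda>r\<in>{..<2 ^ n}. levy_step Z x (l / 2 ^ n) r \<omega>))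
          borel (step_sample n l 0)"
      using grid_sample_increment[of n Z x 0 l]
      by (subst distr_distr[OF step_sample_measurable m]) (auto simp: b o_def)
    then show ?thesis
      using l by (simp add: levy_step_vector_law[OF Z x])
  qed
  show ?thesis
  proof (rule measure_eqI_generator_eq[OF Int_stable_dyadic_cylinders dyadic_cylinders_Pow, where A = "\<lambda>_. cadlag_paths"])
    fix A assume "A \<in> dyadic_cylinders"
    then obtain n Y where A: "A = dyadic_cylinder n Y" "Y \<in> sets borel"
      unfolding dyadic_cylinders_def by blast
    have "emeasure (distr M dyadic_algebra (increment Z x l)) A =
        emeasure (distr M borel (\<lambda>\<omega>. grid_sample (2 ^ n) (increment Z x l \<omega>))) Y" if x: "0 \<le> x" for x
    proof -
      have "A \<in> sets dyadic_algebra"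
        using A unfolding sets_dyadic_algebra by (auto intro!: sigma_sets.Basic simp: dyadic_cylinders_def)
      then have "emeasure (distr M dyadic_algebra (increment Z x l)) A = emeasure M (increment Z x l -` A \<inter> space M)"
        by (intro emeasure_distr increment_measurable_dyadic[OF Z x l])
      also have "increment Z x l -` A \<inter> space M =
          (\<lambda>\<omega>. grid_sample (2 ^ n) (increment Z x l \<omega>)) -` Y \<inter> space M"
        using increment_cadlag[OF Z x l] unfolding A(1) dyadic_cylinder_def by blast
      also have "emeasure M \<dots> = emeasure (distr M borel (\<lambda>\<omega>. grid_sample (2 ^ n) (increment Z x l \<omega>))) Y"
        by (rule emeasure_distr[symmetric, OF grid_sample_increment_measurable[OF Z x l] A(2)])
      finally show ?thesis .
    qed
    from this[OF x] this[OF order_refl]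
    show "emeasure (distr M dyadic_algebra (increment Z x l)) A =
        emeasure (distr M dyadic_algebra (increment Z 0 l)) A"
      by (simp add: samp[OF x] samp[OF order_refl])
  next
    interpret D: prob_space "distr M dyadic_algebra (increment Z x l)"
      by (rule prob_space_distr) (rule increment_measurable_dyadic[OF assms])
    show "emeasure (distr M dyadic_algebra (increment Z x l)) cadlag_paths \<noteq> \<infinity>" for i :: nat
      using D.emeasure_finite by simp
  qed (auto simp: sets_dyadic_algebra cadlag_paths_in_dyadic_cylinders)
qed

text \<open>\<open>increment_law\<close> lives on the Skorokhod Borel sets and stationarity on
  \<open>dyadic_algebra\<close>; probabilities of events in \<open>M\<close> mediate between the
  two.\<close>

lemma prob_increment:
  assumes Z: "levy_process M Z" and x: "0 \<le> x" and l: "0 < l"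
    and B: "B \<in> sets (borel_of skorokhod_topology)"
  shows "measure M (increment Z x l -` B \<inter> space M) = measure (increment_law M Z l) B"
proof -
  have B': "B \<in> sets dyadic_algebra" using B skorokhod_borel_le_dyadic by blast
  have "measure M (increment Z x l -` B \<inter> space M) = measure (distr M dyadic_algebra (increment Z x l)) B"
    by (rule measure_distr[symmetric, OF increment_measurable_dyadic[OF Z x l] B'])
  also have "\<dots> = measure (distr M dyadic_algebra (increment Z 0 l)) B"
    by (simp add: increment_law_stationary[OF Z x l])
  also have "\<dots> = measure M (increment Z 0 l -` B \<inter> space M)"
    by (rule measure_distr[OF increment_measurable_dyadic[OF Z order_refl l] B'])
  also have "\<dots> = measure (increment_law M Z l) B"
    unfolding increment_law_def
    by (rule measure_distr[symmetric, OF increment_measurable_skorokhod[OF Z order_refl l] B])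
  finally show ?thesis .
qed

text \<open>The windows from j l to (j + 1) l consist of disjoint blocks of one sequence of
  independent steps. Testing cylinders is enough, as they form an intersection-stable generator
  containing the whole space.\<close>

lemma increments_indep:
  assumes Z: "levy_process M Z" and l: "0 < l"
  shows "prob_space.indep_vars M (\<lambda>_. dyadic_algebra) (\<lambda>j. increment Z (real j * l) l) {..<m::nat}"
proof -
  interpret prob_space M by (rule levy_processD(1)[OF Z])
  have x: "0 \<le> real j * l" for j using l by simp
  show ?thesis
  proof (cases "m = 0")
    case True
    then show ?thesis
      by (simp add: indep_vars_def indep_sets_def)
  next
    case False
    show ?thesis
    proof (subst indep_vars_finite[where E = "\<lambda>_. dyadic_cylinders"])
      show "{..<m} \<noteq> {}" using False by auto
      show "\<forall>A\<in>{..<m} \<rightarrow> dyadic_cylinders.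
        prob (\<Inter>j\<in>{..<m}. increment Z (real j * l) l -` A j \<inter> space M) =
        (\<Prod>j\<in>{..<m}. prob (increment Z (real j * l) l -` A j \<inter> space M))"
      proof
        fix A assume "A \<in> {..<m} \<rightarrow> dyadic_cylinders"
        then have "\<forall>j\<in>{..<m}. \<exists>n Y. Y \<in> sets borel \<and> A j = dyadic_cylinder n Y"
          unfolding dyadic_cylinders_def by blast
        then obtain n Y where nY: "\<And>j. j < m \<Longrightarrow> Y j \<in> sets borel \<and> A j = dyadic_cylinder (n j) (Y j)"
          unfolding lessThan_iff Ball_def by metis
        \<comment> \<open>One dyadic level for all windows, so that all blocks are cut from the same
          sequence of steps.\<close>
        define N where "N = Max (n ` {..<m})"
        have "n j \<le> N" if "j < m" for j using that by (simp add: N_def)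
        then have "\<forall>j<m. \<exists>Y'\<in>sets borel. A j = dyadic_cylinder N Y'"
          using nY dyadic_cylinder_refine by metis
        then obtain Y' where Y': "\<And>j. j < m \<Longrightarrow> Y' j \<in> sets borel \<and> A j = dyadic_cylinder N (Y' j)"
          by metis
        define X where "X j \<omega> = grid_sample (2 ^ N) (increment Z (real j * l) l \<omega>)" for j \<omega>
        have eq: "increment Z (real j * l) l -` A j \<inter> space M = X j -` Y' j \<inter> space M" if "j < m" for j
          using increment_cadlag[OF Z x l] Y'[OF that] unfolding X_def dyadic_cylinder_def by blast
        have "indep_vars (\<lambda>j. PiM (step_block N j) (\<lambda>_. borel))
           (\<lambda>j \<omega>. \<lambda>r\<in>step_block N j. levy_step Z 0 (l / 2 ^ N) r \<omega>) {..<m}"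
        proof (rule indep_vars_restrict[OF levy_step_indep[OF Z, of 0 _ "m * 2 ^ N"]])
          show "step_block N j \<subseteq> {..<m * 2 ^ N}" if "j \<in> {..<m}" for j
          proof -
            have "Suc j * 2 ^ N \<le> m * 2 ^ N" using that by (intro mult_le_mono1) auto
            then show ?thesis by (auto simp: step_block_def)
          qed
          have "step_block N i \<inter> step_block N j = {}" if "i < j" for i j
          proof -
            have "Suc i * 2 ^ N \<le> j * 2 ^ N" using that by (intro mult_le_mono1) auto
            then show ?thesis by (auto simp: step_block_def)
          qed
          then show "disjoint_family_on (step_block N) {..<m}"
            unfolding disjoint_family_on_def by (metis inf_commute nat_neq_iff)
        qed (use l in auto)
        then have "indep_vars (\<lambda>_. borel)
            (\<lambda>j \<omega>. step_sample N l j (\<lambda>r\<in>step_block N j. levy_step Z 0 (l / 2 ^ N) r \<omega>)) {..<m}"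
          by (rule indep_vars_compose2) (rule step_sample_measurable, simp)
        then have "indep_vars (\<lambda>_. borel) X {..<m}"
          using grid_sample_increment[of N Z 0 _ l] by (simp add: X_def[abs_def])
        then have "prob (\<Inter>j\<in>{..<m}. X j -` Y' j \<inter> space M) = (\<Prod>j\<in>{..<m}. prob (X j -` Y' j \<inter> space M))"
          by (rule indep_varsD_finite) (use False Y' in auto)
        then show "prob (\<Inter>j\<in>{..<m}. increment Z (real j * l) l -` A j \<inter> space M) =
          (\<Prod>j\<in>{..<m}. prob (increment Z (real j * l) l -` A j \<inter> space M))"
          by (simp add: eq)
      qed
    qed (use increment_measurable_dyadic[OF Z x l] Int_stable_dyadic_cylinders dyadic_cylinders_Pow
        cadlag_paths_in_dyadic_cylinders in \<open>simp_all add: sets_dyadic_algebra\<close>)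
  qed
qed

lemma prob_increments_avoid:
  assumes Z: "levy_process M Z" and l: "0 < l"
    and B: "B \<in> sets (borel_of skorokhod_topology)"
  shows "measure M {\<omega> \<in> space M. \<forall>j<m::nat. increment Z (real j * l) l \<omega> \<notin> B} =
    (1 - measure (increment_law M Z l) B) ^ m"
proof (cases "m = 0")
  case True
  interpret prob_space M by (rule levy_processD(1)[OF Z])
  show ?thesis using True by (simp add: prob_space)
next
  case False
  interpret prob_space M by (rule levy_processD(1)[OF Z])
  have x: "0 \<le> real j * l" for j using l by simp
  have B': "B \<in> sets dyadic_algebra" using B skorokhod_borel_le_dyadic by blast
  let ?C = "cadlag_paths - B"
  have C: "?C \<in> sets dyadic_algebra" using sets.compl_sets[OF B'] by simp
  have eq: "increment Z (real j * l) l -` ?C \<inter> space M =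
      space M - (increment Z (real j * l) l -` B \<inter> space M)" for j
    using increment_cadlag[OF Z x l] by blast
  have "{\<omega> \<in> space M. \<forall>j<m. increment Z (real j * l) l \<omega> \<notin> B} =
      (\<Inter>j\<in>{..<m}. increment Z (real j * l) l -` ?C \<inter> space M)"
    using False increment_cadlag[OF Z x l] by auto
  also have "prob \<dots> = (\<Prod>j\<in>{..<m}. prob (increment Z (real j * l) l -` ?C \<inter> space M))"
    by (rule indep_varsD_finite[OF increments_indep[OF Z l]]) (use False C in auto)
  also have "\<dots> = (\<Prod>j\<in>{..<m}. 1 - measure (increment_law M Z l) B)"
  proof (rule prod.cong[OF refl])
    fix j
    have "increment Z (real j * l) l -` B \<inter> space M \<in> events"
      by (rule measurable_sets[OF increment_measurable_dyadic[OF Z x l] B'])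
    then show "prob (increment Z (real j * l) l -` ?C \<inter> space M) = 1 - measure (increment_law M Z l) B"
      unfolding eq by (simp add: prob_compl prob_increment[OF Z x l B])
  qed
  finally show ?thesis by simp
qed

section \<open>Borel-Cantelli estimates\<close>

text \<open>The strict gap between \<open>b\<close> and the infimum absorbs the error in the limsup,
  so the bound carries no prefactor.\<close>

lemma large_deviations_upper_bound:
  assumes ldp: "large_deviations T P J" and F: "closedin T F" and b: "ereal b < (INF f\<in>F. J f)"
  shows "\<forall>\<^sub>F l in at_top. measure (P l) F \<le> exp (- b * l)"
proof -
  have "Limsup at_top (\<lambda>l. ereal (1 / l) * ln_ereal (measure (P l) F)) \<le> - (INF f\<in>F. J f)"
    using ldp F by (simp add: large_deviations_def)
  also have "\<dots> < - ereal b" using b by (simp only: ereal_minus_less_minus)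
  finally have "\<forall>\<^sub>F l in at_top. ereal (1 / l) * ln_ereal (measure (P l) F) < - ereal b"
    by (rule Limsup_lessD)
  then show ?thesis using eventually_gt_at_top[of 0]
  proof eventually_elim
    fix l :: real assume l: "ereal (1 / l) * ln_ereal (measure (P l) F) < - ereal b" "0 < l"
    show "measure (P l) F \<le> exp (- b * l)"
    proof (cases "measure (P l) F \<le> 0")
      case True
      then show ?thesis by (rule order_trans) simp
    next
      case False
      then have "ln (measure (P l) F) < - b * l" using l by (simp add: ln_ereal_def field_simps)
      then have "exp (ln (measure (P l) F)) \<le> exp (- b * l)" by (simp only: exp_le_cancel_iff less_imp_le)
      then show ?thesis using False by simp
    qed
  qed
qed

lemma large_deviations_lower_bound:
  assumes ldp: "large_deviations T P J" and G: "openin T G" and f: "f \<in> G" and b: "J f < ereal b"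
  shows "\<forall>\<^sub>F l in at_top. exp (- b * l) \<le> measure (P l) G"
proof -
  have "- ereal b < - J f" using b by (simp only: ereal_minus_less_minus)
  also have "\<dots> \<le> - (INF f\<in>G. J f)" using f by (simp add: INF_lower)
  also have "\<dots> \<le> Liminf at_top (\<lambda>l. ereal (1 / l) * ln_ereal (measure (P l) G))"
    using ldp G by (simp add: large_deviations_def)
  finally have "\<forall>\<^sub>F l in at_top. - ereal b < ereal (1 / l) * ln_ereal (measure (P l) G)"
    by (rule less_LiminfD)
  then show ?thesis using eventually_gt_at_top[of 0]
  proof eventually_elim
    fix l :: real assume l: "- ereal b < ereal (1 / l) * ln_ereal (measure (P l) G)" "0 < l"
    show "exp (- b * l) \<le> measure (P l) G"
    proof (cases "measure (P l) G \<le> 0")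
      case True
      \<comment> \<open>Measure zero would make the normalized logarithm minus infinity, against its
        lower bound.\<close>
      then show ?thesis using l by (simp add: ln_ereal_def)
    next
      case False
      then have "- b * l < ln (measure (P l) G)" using l by (simp add: ln_ereal_def field_simps)
      then have "exp (- b * l) \<le> exp (ln (measure (P l) G))" by (simp only: exp_le_cancel_iff less_imp_le)
      then show ?thesis using False by simp
    qed
  qed
qed

text \<open>Lower semicontinuity alone would allow rates outside \<open>U\<close> to come
  arbitrarily close to \<open>a\<close>; compactness of the level set at a + 1 prevents it. That set
  is covered by \<open>U\<close> and the increasing open sets where the rate exceeds a + 1 / (k +
  1), so \<open>U\<close> and a single one of them suffice.\<close>

lemma good_rate_function_gap:
  fixes a :: real
  assumes J: "good_rate_function T J" and U: "openin T U"
    and sub: "{f \<in> topspace T. J f \<le> ereal a} \<subseteq> U"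
  shows "\<exists>b>a. ereal b < (INF f\<in>topspace T - U. J f)"
proof -
  define W where "W k = {f \<in> topspace T. ereal (a + 1 / real (Suc k)) < J f}" for k
  have W: "openin T (W k)" for k
    using J by (simp add: good_rate_function_def rate_function_def W_def)
  have Wmono: "W i \<subseteq> W k" if "i \<le> k" for i k
  proof -
    have "a + 1 / real (Suc k) \<le> a + 1 / real (Suc i)" using that by (simp add: field_simps)
    then have "ereal (a + 1 / real (Suc k)) \<le> ereal (a + 1 / real (Suc i))" by simp
    then show ?thesis unfolding W_def using le_less_trans by blast
  qed
  have compact: "compactin T {f \<in> topspace T. J f \<le> ereal (a + 1)}"
    using J by (simp add: good_rate_function_def)
  have cover: "{f \<in> topspace T. J f \<le> ereal (a + 1)} \<subseteq> \<Union> (range (\<lambda>k. U \<union> W k))"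
  proof
    fix f assume f: "f \<in> {f \<in> topspace T. J f \<le> ereal (a + 1)}"
    show "f \<in> \<Union> (range (\<lambda>k. U \<union> W k))"
    proof (cases "J f \<le> ereal a")
      case False
      then obtain r where r: "ereal a < ereal r" "ereal r < J f"
        using ereal_dense2[of "ereal a" "J f"] by (auto simp: not_le)
      obtain k where "1 / real (Suc k) < r - a" using nat_approx_posE[of "r - a"] r by auto
      then have "ereal (a + 1 / real (Suc k)) < ereal r" by simp
      then have "ereal (a + 1 / real (Suc k)) < J f" using r(2) by (rule less_trans)
      then have "f \<in> W k" using f unfolding W_def by blast
      then show ?thesis by blast
    qed (use f sub in blast)
  qed
  have "openin T V" if "V \<in> range (\<lambda>k. U \<union> W k)" for V
    using that openin_Un[OF U W] by blast
  then obtain \<F> where \<F>: "finite \<F>" "\<F> \<subseteq> range (\<lambda>k. U \<union> W k)"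
      "{f \<in> topspace T. J f \<le> ereal (a + 1)} \<subseteq> \<Union> \<F>"
    using compactinD[OF compact _ cover] by blast
  then obtain S where S: "finite S" "\<F> = (\<lambda>k. U \<union> W k) ` S"
    by (meson finite_subset_image)
  \<comment> \<open>Inserting 0 keeps \<open>Max\<close> meaningful when the subcover is
    empty.\<close>
  define k where "k = Max (insert 0 S)"
  have k: "W i \<subseteq> W k" if "i \<in> S" for i using that S(1) by (intro Wmono) (simp add: k_def)
  have "ereal (a + 1 / real (Suc k)) \<le> J f" if f: "f \<in> topspace T - U" for f
  proof (cases "J f \<le> ereal (a + 1)")
    case True
    then have "f \<in> W k" using f \<F>(3) S(2) k by blast
    then show ?thesis by (simp add: W_def less_imp_le)
  next
    case False
    have "ereal (a + 1 / real (Suc k)) \<le> ereal (a + 1)" by simp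
    also have "\<dots> \<le> J f" using False by simp
    finally show ?thesis .
  qed
  then have "ereal (a + 1 / real (Suc k)) \<le> (INF f\<in>topspace T - U. J f)"
    by (rule INF_greatest)
  \<comment> \<open>Halving the gap turns the bound on the infimum into a strict one.\<close>
  moreover have "ereal (a + 1 / (2 * real (Suc k))) < ereal (a + 1 / real (Suc k))"
    by (simp add: field_simps)
  ultimately have "ereal (a + 1 / (2 * real (Suc k))) < (INF f\<in>topspace T - U. J f)"
    by (rule less_le_trans[rotated])
  moreover have "a < a + 1 / (2 * real (Suc k))" by simp
  ultimately show ?thesis by blast
qed

section \<open>Windows, and almost sure statements along them\<close>

lemma window_bounds:
  assumes c: "0 < c" and n: "1 \<le> n"
  shows "exp (real (window c n) / c) \<le> real n" "real n < exp (real (Suc (window c n)) / c)"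
proof -
  have "0 \<le> c * ln (real n)" using c n by simp
  then have "real (window c n) = \<lfloor>c * ln (real n)\<rfloor>" by (simp add: window_def)
  then have "real (window c n) \<le> c * ln (real n)" "c * ln (real n) < real (Suc (window c n))"
    by linarith+
  then have "real (window c n) / c \<le> ln (real n)" "ln (real n) < real (Suc (window c n)) / c"
    using c by (simp_all add: field_simps)
  moreover have "exp (ln (real n)) = real n" using n by simp
  ultimately show "exp (real (window c n) / c) \<le> real n" "real n < exp (real (Suc (window c n)) / c)"
    by (metis exp_le_cancel_iff, metis exp_less_cancel_iff)
qed

lemma filterlim_window:
  assumes "0 < c"
  shows "filterlim (window c) at_top sequentially"
proof -
  have "filterlim (\<lambda>n. c * ln (real n)) at_top sequentially"
    using assms by (intro filterlim_tendsto_pos_mult_at_top[OF tendsto_const]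
        filterlim_compose[OF ln_at_top filterlim_real_sequentially])
  then have "filterlim (\<lambda>n. \<lfloor>c * ln (real n)\<rfloor>) at_top sequentially"
    by (rule filterlim_compose[OF filterlim_floor_sequentially])
  then have "filterlim (\<lambda>n. nat \<lfloor>c * ln (real n)\<rfloor>) at_top sequentially"
    by (rule filterlim_compose[OF filterlim_nat_sequentially])
  then show ?thesis by (simp add: window_def[abs_def])
qed

lemma increment_event:
  assumes "levy_process M Z" "0 \<le> x" "0 < l" "B \<in> sets (borel_of skorokhod_topology)"
  shows "{\<omega> \<in> space M. increment Z x l \<omega> \<in> B} \<in> sets M"
    and "measure M {\<omega> \<in> space M. increment Z x l \<omega> \<in> B} = measure (increment_law M Z l) B"
proof -
  have eq: "{\<omega> \<in> space M. increment Z x l \<omega> \<in> B} = increment Z x l -` B \<inter> space M" by blast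
  show "{\<omega> \<in> space M. increment Z x l \<omega> \<in> B} \<in> sets M"
    unfolding eq by (rule measurable_sets[OF increment_measurable_skorokhod[OF assms(1-3)] assms(4)])
  show "measure M {\<omega> \<in> space M. increment Z x l \<omega> \<in> B} = measure (increment_law M Z l) B"
    unfolding eq by (rule prob_increment[OF assms])
qed

text \<open>
  The window takes the same value \<open>a\<close> for all \<open>n\<close> between \<open>exp (a / c)\<close> and \<open>exp ((a + 1) / c)\<close>,
  so that the Borel-Cantelli lemma applied along \<open>a\<close>, not along \<open>n\<close>, needs only a rate \<open>b > 1 / c\<close>.
\<close>

lemma AE_increments_avoid:
  assumes Z: "levy_process M Z" and c: "0 < c"
    and B: "B \<in> sets (borel_of skorokhod_topology)" and b: "1 / c < b"
    and P: "\<forall>\<^sub>F l in at_top. measure (increment_law M Z l) B \<le> exp (- b * l)"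
  shows "AE \<omega> in M. \<forall>\<^sub>F a::nat in sequentially. \<forall>x::nat. real x \<le> exp (real (Suc a) / c) \<longrightarrow>
    increment Z (real x) (real a) \<omega> \<notin> B"
proof -
  interpret prob_space M by (rule levy_processD(1)[OF Z])
  \<comment> \<open>Every \<open>n\<close> with window \<open>a\<close> is below exp ((a + 1) / c),
    so these starting points serve all such \<open>n\<close> at once.\<close>
  define m where "m a = nat \<lfloor>exp (real (Suc a) / c)\<rfloor>" for a
  \<comment> \<open>Window 0 is set apart because the measurability of increment functions is
    established for positive lengths.\<close>
  define A where "A a = (if a = 0 then {} else
    (\<Union>x\<in>{..m a}. {\<omega> \<in> space M. increment Z (real x) (real a) \<omega> \<in> B}))" for a
  have ev: "{\<omega> \<in> space M. increment Z (real x) (real a) \<omega> \<in> B} \<in> events" if "a > 0" for a x :: nat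
    using that by (intro increment_event(1)[OF Z _ _ B]) auto
  have A: "A a \<in> events" for a
    unfolding A_def using ev by (auto intro!: sets.finite_UN)
  have "\<forall>\<^sub>F a in sequentially. measure (increment_law M Z (real a)) B \<le> exp (- b * real a)"
    using eventually_compose_filterlim[OF P filterlim_real_sequentially] .
  \<comment> \<open>The factor exp (1 / c) comes from a + 1 in place of a, and the factor 2 from
    counting the starting point 0 as well.\<close>
  then have bound: "\<forall>\<^sub>F a in sequentially.
      norm (prob (A a)) \<le> 2 * exp (1 / c) * exp (- (b - 1 / c)) ^ a"
    using eventually_gt_at_top[of 0]
  proof eventually_elim
    fix a :: nat assume a: "measure (increment_law M Z (real a)) B \<le> exp (- b * real a)" "0 < a"
    have "prob (A a) \<le> (\<Sum>x\<in>{..m a}. prob {\<omega> \<in> space M. increment Z (real x) (real a) \<omega> \<in> B})"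
      unfolding A_def using a(2) ev by (auto intro!: finite_measure_subadditive_finite)
    also have "\<dots> = (\<Sum>x\<in>{..m a}. measure (increment_law M Z (real a)) B)"
      using a(2) by (intro sum.cong refl increment_event(2)[OF Z _ _ B]) auto
    also have "\<dots> = (real (m a) + 1) * measure (increment_law M Z (real a)) B"
      by simp
    also have "\<dots> \<le> (2 * exp (real (Suc a) / c)) * exp (- b * real a)"
    proof (intro mult_mono a)
      have "real (m a) \<le> exp (real (Suc a) / c)" by (simp add: m_def)
      moreover have "1 \<le> exp (real (Suc a) / c)" using c by simp
      ultimately show "real (m a) + 1 \<le> 2 * exp (real (Suc a) / c)" by linarith
    qed auto
    also have "\<dots> = 2 * (exp (real (Suc a) / c) * exp (- b * real a))" by simp
    also have "exp (real (Suc a) / c) * exp (- b * real a) = exp (1 / c + real a * (- (b - 1 / c)))"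
      unfolding exp_add[symmetric] by (simp add: add_divide_distrib algebra_simps)
    also have "\<dots> = exp (1 / c) * exp (- (b - 1 / c)) ^ a"
      by (simp only: exp_add exp_of_nat_mult)
    finally show "norm (prob (A a)) \<le> 2 * exp (1 / c) * exp (- (b - 1 / c)) ^ a" by simp
  qed
  have "summable (\<lambda>a. 2 * exp (1 / c) * exp (- (b - 1 / c)) ^ a)"
    using b by (intro summable_mult summable_geometric) simp
  then have "summable (\<lambda>a. prob (A a))"
    by (rule summable_comparison_test_ev[OF bound])
  then have "AE \<omega> in M. \<forall>\<^sub>F a in sequentially. \<omega> \<in> space M - A a"
    by (intro borel_cantelli_AE1 A) (auto simp: emeasure_eq_measure)
  then show ?thesis
  proof eventually_elim
    fix \<omega> assume "\<forall>\<^sub>F a in sequentially. \<omega> \<in> space M - A a"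
    then show "\<forall>\<^sub>F a::nat in sequentially. \<forall>x::nat. real x \<le> exp (real (Suc a) / c) \<longrightarrow>
        increment Z (real x) (real a) \<omega> \<notin> B"
      using eventually_gt_at_top[of 0]
    proof eventually_elim
      fix a :: nat assume a: "\<omega> \<in> space M - A a" "0 < a"
      have "x \<in> {..m a}" if "real x \<le> exp (real (Suc a) / c)" for x :: nat
        using that by (simp add: m_def le_nat_iff le_floor_iff)
      then show "\<forall>x::nat. real x \<le> exp (real (Suc a) / c) \<longrightarrow> increment Z (real x) (real a) \<omega> \<notin> B"
        using a unfolding A_def by fastforce
    qed
  qed
qed

text \<open>Cubing x \<le> exp x at x = k a / 3 gives (k a) ^ 3 / 27 \<le> exp (k a), and a > 27 / k
  ^ 3 makes the left side exceed the square of a.\<close>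

lemma eventually_le_exp_div:
  fixes k :: real
  assumes k: "0 < k"
  shows "\<forall>\<^sub>F a::nat in sequentially. real a \<le> exp (k * real a) / real a"
proof -
  have "\<forall>\<^sub>F a in sequentially. 27 / k ^ 3 < real a"
    using filterlim_real_sequentially by (simp add: filterlim_at_top_dense)
  then show ?thesis
  proof eventually_elim
    fix a :: nat assume "27 / k ^ 3 < real a"
    then have a: "27 < real a * k ^ 3" "0 < real a"
      using k by (simp add: field_simps, smt (verit) zero_less_divide_iff zero_less_power)
    have "real a * real a * 27 \<le> real a * real a * (real a * k ^ 3)"
      using a by (intro mult_left_mono) auto
    then have "real a * real a \<le> (k * real a / 3) ^ 3"
      by (simp add: power3_eq_cube field_simps)
    also have "\<dots> \<le> exp (k * real a / 3) ^ 3"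
    proof (rule power_mono)
      show "k * real a / 3 \<le> exp (k * real a / 3)"
        using exp_ge_add_one_self[of "k * real a / 3"] by linarith
    qed (use k in simp)
    also have "\<dots> = exp (k * real a)" by (simp add: exp_of_nat_mult[symmetric])
    finally show "real a \<le> exp (k * real a) / real a" using a by (simp add: field_simps)
  qed
qed

text \<open>The windows starting at multiples of \<open>a\<close> are disjoint, hence independent,
  and about exp (a / c) / a of them fit below exp (a / c). With m windows of hitting probability p,
  all of them miss with probability at most exp (- m p), and m p is at least a - 1. As exp (a / c)
  is a lower bound for every \<open>n\<close> with window \<open>a\<close>, one hit serves all these
  \<open>n\<close>.\<close>

lemma AE_increments_hit:
  assumes Z: "levy_process M Z"
    and B: "B \<in> sets (borel_of skorokhod_topology)" and b: "0 \<le> b" "b < 1 / c"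
    and P: "\<forall>\<^sub>F l in at_top. exp (- b * l) \<le> measure (increment_law M Z l) B"
  shows "AE \<omega> in M. \<forall>\<^sub>F a::nat in sequentially. \<exists>x::nat. real x + real a \<le> exp (real a / c) \<and>
    increment Z (real x) (real a) \<omega> \<in> B"
proof -
  interpret prob_space M by (rule levy_processD(1)[OF Z])
  define m where "m a = nat \<lfloor>exp (real a / c) / real a\<rfloor>" for a :: nat
  define A where "A a = (if a = 0 then {} else
    {\<omega> \<in> space M. \<forall>j<m a. increment Z (real j * real a) (real a) \<omega> \<notin> B})" for a :: nat
  have A: "A a \<in> events" for a
  proof (cases "a = 0")
    case False
    then have "A a = space M - (\<Union>j\<in>{..<m a}. {\<omega> \<in> space M. increment Z (real j * real a) (real a) \<omega> \<in> B})"
      by (auto simp: A_def)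
    moreover have "{\<omega> \<in> space M. increment Z (real j * real a) (real a) \<omega> \<in> B} \<in> events" for j :: nat
      using False by (intro increment_event(1)[OF Z _ _ B]) auto
    ultimately show ?thesis by auto
  qed (simp add: A_def)
  have "\<forall>\<^sub>F a in sequentially. exp (- b * real a) \<le> measure (increment_law M Z (real a)) B"
    using eventually_compose_filterlim[OF P filterlim_real_sequentially] .
  moreover have "\<forall>\<^sub>F a::nat in sequentially. real a \<le> exp ((1 / c - b) * real a) / real a"
    using b by (intro eventually_le_exp_div) simp
  ultimately have bound: "\<forall>\<^sub>F a in sequentially. norm (prob (A a)) \<le> exp 1 * exp (- 1) ^ a"
    using eventually_gt_at_top[of 0]
  proof eventually_elim
    fix a :: nat
    assume a: "exp (- b * real a) \<le> measure (increment_law M Z (real a)) B"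
      "real a \<le> exp ((1 / c - b) * real a) / real a" "0 < a"
    let ?p = "measure (increment_law M Z (real a)) B"
    have p1: "?p \<le> 1"
      using increment_event(2)[OF Z order_refl, of "real a" B] a(3) B by (metis of_nat_0_less_iff prob_le_1)
    have "prob (A a) = (1 - ?p) ^ m a"
      using prob_increments_avoid[OF Z _ B, of "real a" "m a"] a(3) by (simp add: A_def)
    also have "\<dots> \<le> exp (- ?p) ^ m a"
      using p1 exp_ge_add_one_self[of "- ?p"] by (intro power_mono) auto
    also have "\<dots> = exp (- (real (m a) * ?p))"
      by (simp add: exp_of_nat_mult[symmetric])
    also have "\<dots> \<le> exp (- (real a - 1))"
    proof -
      have "exp (real a / c) / real a - 1 \<le> real (m a)" by (simp add: m_def)
      then have "(exp (real a / c) / real a - 1) * exp (- b * real a) \<le> real (m a) * exp (- b * real a)"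
        by (intro mult_right_mono) auto
      also have "\<dots> \<le> real (m a) * ?p" using a(1) by (intro mult_left_mono) auto
      finally have *: "(exp (real a / c) / real a - 1) * exp (- b * real a) \<le> real (m a) * ?p" .
      have "exp (real a / c) * exp (- b * real a) = exp ((1 / c - b) * real a)"
        unfolding exp_add[symmetric] by (simp add: algebra_simps)
      then have "(exp (real a / c) / real a - 1) * exp (- b * real a) =
          exp ((1 / c - b) * real a) / real a - exp (- b * real a)"
        by (simp add: left_diff_distrib)
      \<comment> \<open>Rounding the number of windows down loses at most one, which costs at most
        exp (- b a) in the exponent; b \<ge> 0 bounds this by 1, the source of the factor exp
        1.\<close>
      moreover have "exp (- b * real a) \<le> 1" using b by simp
      ultimately have "real a - 1 \<le> real (m a) * ?p" using * a(2) by linarith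
      then show ?thesis by simp
    qed
    also have "\<dots> = exp (1 + real a * (- 1))" by simp
    also have "\<dots> = exp 1 * exp (- 1) ^ a" by (simp only: exp_add exp_of_nat_mult)
    finally show "norm (prob (A a)) \<le> exp 1 * exp (- 1) ^ a" by simp
  qed
  have "summable (\<lambda>a. exp 1 * exp (- 1 :: real) ^ a)"
    by (intro summable_mult summable_geometric) simp
  then have "summable (\<lambda>a. prob (A a))"
    by (rule summable_comparison_test_ev[OF bound])
  then have "AE \<omega> in M. \<forall>\<^sub>F a in sequentially. \<omega> \<in> space M - A a"
    by (intro borel_cantelli_AE1 A) (auto simp: emeasure_eq_measure)
  then show ?thesis
  proof eventually_elim
    fix \<omega> assume "\<forall>\<^sub>F a in sequentially. \<omega> \<in> space M - A a"
    then show "\<forall>\<^sub>F a::nat in sequentially. \<exists>x::nat. real x + real a \<le> exp (real a / c) \<and>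
        increment Z (real x) (real a) \<omega> \<in> B"
      using eventually_gt_at_top[of 0]
    proof eventually_elim
      fix a :: nat assume a: "\<omega> \<in> space M - A a" "0 < a"
      then obtain j where j: "j < m a" "increment Z (real j * real a) (real a) \<omega> \<in> B"
        by (auto simp: A_def)
      have "real (Suc j) \<le> real (m a)" using j by simp
      also have "\<dots> \<le> exp (real a / c) / real a" by (simp add: m_def)
      finally have "real (j * a) + real a \<le> exp (real a / c)" using a(2) by (simp add: field_simps)
      then show "\<exists>x::nat. real x + real a \<le> exp (real a / c) \<and> increment Z (real x) (real a) \<omega> \<in> B"
        using j(2) by (intro exI[of _ "j * a"]) simp
    qed
  qed
qed

section \<open>Almost sure statements and negligible sets\<close>

lemma ultimately_conegligible:
  assumes AE: "AE \<omega> in M. \<forall>\<^sub>F n in sequentially. \<omega> \<in> A n" and sub: "\<And>n. A n \<subseteq> space M"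
  shows "ultimately_event A \<in> conegligible_sets M"
proof -
  \<comment> \<open>The sets \<open>A n\<close> may be nonmeasurable, so the exceptional set is only
    covered by a null set, as in the definition of negligible sets.\<close>
  obtain N where N: "N \<in> null_sets M" "{\<omega> \<in> space M. \<not> (\<forall>\<^sub>F n in sequentially. \<omega> \<in> A n)} \<subseteq> N"
    using AE by (auto elim!: AE_E)
  have "\<omega> \<in> ultimately_event A" if w: "\<omega> \<in> space M - N" for \<omega>
  proof -
    obtain n where n: "\<And>k. n \<le> k \<Longrightarrow> \<omega> \<in> A k"
      using N(2) w unfolding eventually_sequentially by blast
    \<comment> \<open>\<open>ultimately_event\<close> ranges over n > 1, hence the maximum with
      2.\<close>
    then have "\<omega> \<in> (\<Inter>k\<in>{max 2 n..}. A k)" by auto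
    moreover have "max 2 n \<in> {1<..}" by auto
    ultimately show ?thesis unfolding ultimately_event_def by blast
  qed
  then have "space M - ultimately_event A \<in> negligible_sets M"
    using N(1) unfolding negligible_sets_def by blast
  moreover have "ultimately_event A \<subseteq> space M"
    using sub unfolding ultimately_event_def by (meson INT_lower UN_least atLeast_iff order_refl order_trans)
  then have "ultimately_event A = space M - (space M - ultimately_event A)" by blast
  ultimately show ?thesis unfolding conegligible_sets_def by blast
qed

lemma not_infinitely_often_AE:
  assumes "infinitely_often_event A \<in> negligible_sets M"
  shows "AE \<omega> in M. \<forall>\<^sub>F n in sequentially. \<omega> \<notin> A n"
proof -
  obtain N where N: "N \<in> null_sets M" "infinitely_often_event A \<subseteq> N"
    using assms unfolding negligible_sets_def by blast
  have "\<forall>\<^sub>F n in sequentially. \<omega> \<notin> A n" if "\<omega> \<notin> N" for \<omega>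
  proof -
    have "\<omega> \<notin> infinitely_often_event A" using that N(2) by blast
    then obtain n where "\<forall>k\<ge>n. \<omega> \<notin> A k" unfolding infinitely_often_event_def by auto
    then show ?thesis unfolding eventually_sequentially by blast
  qed
  then show ?thesis using AE_not_in[OF N(1)] by (rule eventually_mono[rotated])
qed

lemma FERL_I:
  assumes "K \<subseteq> E"
    and "\<And>\<epsilon>. 0 < \<epsilon> \<Longrightarrow> AE \<omega> in M. \<forall>\<^sub>F n in sequentially. L n \<omega> \<subseteq> enlargement E d K \<epsilon>"
    and "\<And>\<epsilon>. 0 < \<epsilon> \<Longrightarrow> AE \<omega> in M. \<forall>\<^sub>F n in sequentially. K \<subseteq> enlargement E d (L n \<omega>) \<epsilon>"
  shows "FERL M E d L K"
  unfolding FERL_def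
proof (intro conjI allI impI ultimately_conegligible)
  fix \<epsilon> :: real assume e: "0 < \<epsilon>"
  show "AE \<omega> in M. \<forall>\<^sub>F n in sequentially. \<omega> \<in> {\<omega> \<in> space M. L n \<omega> \<subseteq> enlargement E d K \<epsilon>}"
    using assms(2)[OF e] AE_space by eventually_elim simp
  show "AE \<omega> in M. \<forall>\<^sub>F n in sequentially. \<omega> \<in> {\<omega> \<in> space M. K \<subseteq> enlargement E d (L n \<omega>) \<epsilon>}"
    using assms(3)[OF e] AE_space by eventually_elim simp
qed (use assms(1) in auto)

section \<open>The functional law\<close>

text \<open>Goodness gives compactness for \<open>T\<close>; on \<open>E'\<close> the topologies of
  \<open>T\<close> and \<open>d\<close> agree, and compactness does not depend on the surrounding
  space.\<close>

lemma level_set_compactin: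
  assumes T: "topspace T = E" and J: "good_rate_function T J"
    and E': "level_set E J a \<subseteq> E'" "Metric_space.mtopology E' d = subtopology T E'"
  shows "compactin (Metric_space.mtopology E' d) (level_set E J a)"
proof -
  have "compactin T (level_set E J a)"
    using J unfolding good_rate_function_def level_set_def T by blast
  then show ?thesis unfolding E'(2) compactin_subtopology using E'(1) by blast
qed

text \<open>The upper large deviations bound needs a set that is closed in \<open>T\<close>, so the
  enlargement is replaced by a union of balls of \<delta>, which is open in \<open>T\<close> and
  contained in it. The radii vary with the centre without control;
  \<open>good_rate_function_gap\<close> asks only that the union be open and contain the level
  set.\<close>

lemma AE_increments_nat_near_level_set:
  assumes Z: "levy_process M Z" and c: "0 < c"
    and incr: "AE \<omega> in M. \<forall>x\<ge>0. \<forall>l>0. increment Z x l \<omega> \<in> E"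
    and T: "topspace T = E"
    and borel: "sets (borel_of T) \<subseteq> sets (borel_of skorokhod_topology)"
    and ldp: "large_deviations T (increment_law M Z) J" and good: "good_rate_function T J"
    and \<delta>: "Metric_space E \<delta>"
    and \<delta>_open: "\<forall>U. openin (Metric_space.mtopology E \<delta>) U \<longrightarrow> openin T U"
    and \<delta>_fine: "\<And>g. g \<in> level_set E J (1 / c) \<Longrightarrow>
      \<exists>\<zeta>>0. {f \<in> E. \<delta> f g < \<zeta>} \<subseteq> {f \<in> E. d f g < \<epsilon>}"
  shows "AE \<omega> in M. \<forall>\<^sub>F n in sequentially.
    increments_nat Z c n \<omega> \<subseteq> enlargement E d (level_set E J (1 / c)) \<epsilon>"
proof -
  let ?K = "level_set E J (1 / c)"
  interpret \<delta>: Metric_space E \<delta> by (rule \<delta>)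
  obtain \<zeta> where \<zeta>: "\<And>g. g \<in> ?K \<Longrightarrow> 0 < \<zeta> g \<and> {f \<in> E. \<delta> f g < \<zeta> g} \<subseteq> {f \<in> E. d f g < \<epsilon>}"
    using bchoice[of ?K "\<lambda>g r. 0 < r \<and> {f \<in> E. \<delta> f g < r} \<subseteq> {f \<in> E. d f g < \<epsilon>}"] \<delta>_fine by blast
  define V where "V = (\<Union>g\<in>?K. \<delta>.mball g (\<zeta> g))"
  have "openin T (\<delta>.mball g (\<zeta> g))" for g using \<delta>_open \<delta>.openin_mball by blast
  then have V: "openin T V" unfolding V_def by (intro openin_Union) blast
  have KE: "?K \<subseteq> E" by (auto simp: level_set_def)
  have "{f \<in> topspace T. J f \<le> ereal (1 / c)} \<subseteq> V"
  proof
    fix f assume "f \<in> {f \<in> topspace T. J f \<le> ereal (1 / c)}"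
    then have f: "f \<in> ?K" by (simp add: level_set_def T)
    then have "f \<in> \<delta>.mball f (\<zeta> f)" using \<zeta> KE by auto
    then show "f \<in> V" using f unfolding V_def by blast
  qed
  from good_rate_function_gap[OF good V this] obtain b where b:
    "1 / c < b" "ereal b < (INF f\<in>topspace T - V. J f)" by blast
  have F: "closedin T (topspace T - V)" by (rule closedin_diff[OF closedin_topspace V])
  have "E - V \<in> sets (borel_of T)"
  proof -
    have "V \<in> sets (borel_of T)" unfolding sets_borel_of using V by (intro sigma_sets.Basic) simp
    from sets.compl_sets[OF this] show ?thesis by (simp add: T)
  qed
  then have B: "E - V \<in> sets (borel_of skorokhod_topology)" using borel by blast
  have VE: "V \<subseteq> enlargement E d ?K \<epsilon>"
  proof
    fix f assume "f \<in> V"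
    then obtain g where g: "g \<in> ?K" "f \<in> \<delta>.mball g (\<zeta> g)" unfolding V_def by blast
    then have "f \<in> {f \<in> E. \<delta> f g < \<zeta> g}" by (simp add: \<delta>.commute)
    then show "f \<in> enlargement E d ?K \<epsilon>"
      using \<zeta>[OF g(1)] g(1) unfolding enlargement_def by blast
  qed
  have "AE \<omega> in M. \<forall>\<^sub>F a::nat in sequentially. \<forall>x::nat. real x \<le> exp (real (Suc a) / c) \<longrightarrow>
    increment Z (real x) (real a) \<omega> \<notin> E - V"
    using large_deviations_upper_bound[OF ldp F b(2)]
    by (intro AE_increments_avoid[OF Z c B b(1)]) (simp add: T)
  then show ?thesis using incr
  proof eventually_elim
    fix \<omega>
    assume av: "\<forall>\<^sub>F a::nat in sequentially. \<forall>x::nat. real x \<le> exp (real (Suc a) / c) \<longrightarrow>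
      increment Z (real x) (real a) \<omega> \<notin> E - V"
    assume inE: "\<forall>x\<ge>0. \<forall>l>0. increment Z x l \<omega> \<in> E"
    have "\<forall>\<^sub>F n in sequentially. \<forall>x::nat. real x \<le> exp (real (Suc (window c n)) / c) \<longrightarrow>
      increment Z (real x) (real (window c n)) \<omega> \<notin> E - V"
      using eventually_compose_filterlim[OF av filterlim_window[OF c]] .
    moreover have "\<forall>\<^sub>F n in sequentially. 1 \<le> window c n"
      using eventually_compose_filterlim[OF eventually_ge_at_top filterlim_window[OF c]] .
    ultimately show "\<forall>\<^sub>F n in sequentially. increments_nat Z c n \<omega> \<subseteq> enlargement E d ?K \<epsilon>"
      using eventually_ge_at_top[of 1]
    proof eventually_elim
      fix n :: nat
      assume n: "\<forall>x::nat. real x \<le> exp (real (Suc (window c n)) / c) \<longrightarrow>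
        increment Z (real x) (real (window c n)) \<omega> \<notin> E - V" "1 \<le> window c n" "1 \<le> n"
      have "increment Z x (window c n) \<omega> \<in> V"
        if x: "x \<in> {0..real n - real (window c n)} \<inter> \<nat>" for x
      proof -
        obtain k where k: "x = real k" using x by (auto elim: Nats_cases)
        have "real k \<le> exp (real (Suc (window c n)) / c)"
          using x window_bounds(2)[OF c n(3)] unfolding k by simp
        then have "increment Z x (window c n) \<omega> \<notin> E - V" using n(1) unfolding k by blast
        moreover have "increment Z x (window c n) \<omega> \<in> E" using inE n(2) by (simp add: k)
        ultimately show ?thesis by blast
      qed
      then show "increments_nat Z c n \<omega> \<subseteq> enlargement E d ?K \<epsilon>"
        using VE unfolding increments_nat_def by blast
    qed
  qed
qed

text \<open>
  Shrinking \<open>g\<close> to \<open>u g\<close> with \<open>u < 1\<close> brings its rate strictly below \<open>1 / c\<close>, by convexity.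
\<close>

lemma level_set_approximation:
  assumes c: "0 < c" and E: "function_vector_space E"
    and ray: "ray_continuous d (level_set E J (1 / c))"
    and E': "convex_paths E'" "null_path \<in> E'" "level_set E J (1 / c) \<subseteq> E'"
    and J: "convex_functional_on E' J" "J null_path = 0"
    and g: "g \<in> level_set E J (1 / c)" and \<epsilon>: "0 < \<epsilon>"
  shows "\<exists>h b. h \<in> level_set E J (1 / c) \<and> d h g < \<epsilon> \<and> J h < ereal b \<and> 0 \<le> b \<and> b < 1 / c"
proof -
  have gJ: "J g \<le> ereal (1 / c)" and gE: "g \<in> E" using g by (simp_all add: level_set_def)
  have "((\<lambda>u. d (\<lambda>s. u * g s) g) \<longlongrightarrow> 0) (at_left 1)"
    using ray g by (simp add: ray_continuous_def)
  from order_tendstoD(2)[OF this \<epsilon>]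
  have "\<forall>\<^sub>F u in at_left 1. d (\<lambda>s. u * g s) g < \<epsilon> \<and> u \<in> {0<..<1}"
    using eventually_at_left_real[of 0 1] by (intro eventually_conj) auto
  from eventually_happens'[OF trivial_limit_at_left_real this]
  obtain u :: real where u: "d (\<lambda>s. u * g s) g < \<epsilon>" "0 < u" "u < 1" by auto
  define h where "h = (\<lambda>s. u * g s)"
  \<comment> \<open>\<open>h\<close> lies on the segment from the null path to \<open>g\<close>, so
    convexity and the zero rate of the null path give rate at most u / c.\<close>
  have eq: "(\<lambda>s. (1 - u) * null_path s + u * g s) = h" by (simp add: h_def null_path_def)
  have gE': "g \<in> E'" using g E'(3) by blast
  have "J h \<le> ereal (1 - u) * J null_path + ereal u * J g"
    using J(1) E'(2) gE' u unfolding convex_functional_on_def eq[symmetric] by simp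
  also have "\<dots> = ereal u * J g" using J(2) by simp
  also have "\<dots> \<le> ereal u * ereal (1 / c)" using gJ u by (intro ereal_mult_left_mono) auto
  finally have hJ: "J h \<le> ereal (u / c)" by simp
  have uc: "u / c < 1 / c" using u c by (simp add: divide_strict_right_mono)
  \<comment> \<open>Room is left above the rate of \<open>h\<close>, because the exponential lower
    bound asks for a strict inequality.\<close>
  then obtain b where b: "u / c < b" "b < 1 / c" using dense by blast
  have "h \<in> E" using E gE unfolding function_vector_space_def h_def by blast
  moreover have "ereal (u / c) \<le> ereal (1 / c)" using uc by simp
  then have "J h \<le> ereal (1 / c)" using hJ by (rule order_trans[rotated])
  ultimately have "h \<in> level_set E J (1 / c)" by (simp add: level_set_def)
  moreover have "ereal (u / c) < ereal b" using b by simp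
  then have "J h < ereal b" using hJ by (rule le_less_trans[rotated])
  moreover have "0 \<le> u / c" using u c by simp
  then have "0 \<le> b" using b(1) by linarith
  ultimately show ?thesis using b(2) u(1) unfolding h_def by blast
qed

text \<open>Closeness is measured by \<delta> because balls of \<delta> are open in \<open>T\<close>
  and so fall under the lower large deviations bound; the passage to \<open>d\<close> is made in
  \<open>theorem3\<close>.\<close>

lemma AE_increments_nat_approach:
  assumes Z: "levy_process M Z" and c: "0 < c"
    and T: "topspace T = E"
    and borel: "sets (borel_of T) \<subseteq> sets (borel_of skorokhod_topology)"
    and ldp: "large_deviations T (increment_law M Z) J"
    and \<delta>: "Metric_space E \<delta>"
    and \<delta>_open: "\<forall>U. openin (Metric_space.mtopology E \<delta>) U \<longrightarrow> openin T U"
    and h: "h \<in> E" "J h < ereal b" "0 \<le> b" "b < 1 / c" and \<zeta>: "0 < \<zeta>"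
  shows "AE \<omega> in M. \<forall>\<^sub>F n in sequentially. \<exists>f\<in>increments_nat Z c n \<omega>. f \<in> E \<and> \<delta> f h < \<zeta>"
proof -
  interpret \<delta>: Metric_space E \<delta> by (rule \<delta>)
  let ?G = "\<delta>.mball h \<zeta>"
  have G: "openin T ?G" using \<delta>_open \<delta>.openin_mball by blast
  then have "?G \<in> sets (borel_of T)" unfolding sets_borel_of by (intro sigma_sets.Basic) simp
  then have B: "?G \<in> sets (borel_of skorokhod_topology)" using borel by blast
  have "h \<in> ?G" using h(1) \<zeta> by simp
  from large_deviations_lower_bound[OF ldp G this, OF h(2)]
  have "AE \<omega> in M. \<forall>\<^sub>F a::nat in sequentially. \<exists>x::nat. real x + real a \<le> exp (real a / c) \<and>
    increment Z (real x) (real a) \<omega> \<in> ?G"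
    by (intro AE_increments_hit[OF Z B h(3,4)])
  then show ?thesis
  proof eventually_elim
    fix \<omega>
    assume hit: "\<forall>\<^sub>F a::nat in sequentially. \<exists>x::nat. real x + real a \<le> exp (real a / c) \<and>
      increment Z (real x) (real a) \<omega> \<in> ?G"
    have "\<forall>\<^sub>F n in sequentially. \<exists>x::nat.
      real x + real (window c n) \<le> exp (real (window c n) / c) \<and>
      increment Z (real x) (real (window c n)) \<omega> \<in> ?G"
      using eventually_compose_filterlim[OF hit filterlim_window[OF c]] .
    then show "\<forall>\<^sub>F n in sequentially. \<exists>f\<in>increments_nat Z c n \<omega>. f \<in> E \<and> \<delta> f h < \<zeta>"
      using eventually_ge_at_top[of 1]
    proof eventually_elim
      fix n :: nat
      assume "\<exists>x::nat. real x + real (window c n) \<le> exp (real (window c n) / c) \<and>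
        increment Z (real x) (real (window c n)) \<omega> \<in> ?G" and n: "1 \<le> n"
      then obtain x :: nat where x: "real x + real (window c n) \<le> exp (real (window c n) / c)"
        "increment Z (real x) (real (window c n)) \<omega> \<in> ?G" by blast
      have "real x \<in> {0..real n - real (window c n)} \<inter> \<nat>"
        using x(1) window_bounds(1)[OF c n] by simp
      then have "increment Z (real x) (real (window c n)) \<omega> \<in> increments_nat Z c n \<omega>"
        unfolding increments_nat_def by blast
      then show "\<exists>f\<in>increments_nat Z c n \<omega>. f \<in> E \<and> \<delta> f h < \<zeta>"
        using x(2) by (auto simp: \<delta>.commute)
    qed
  qed
qed

text \<open>The exceptional null set depends on \<open>g\<close> and \<open>K\<close> may be
  uncountable, so the almost sure statements are combined over a finite net only; the triangle
  inequality covers the rest of \<open>K\<close>.\<close>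

lemma AE_totally_bounded_near:
  assumes d: "Metric_space E d" and KE: "K \<subseteq> E"
    and tb: "\<And>\<epsilon>. 0 < \<epsilon> \<Longrightarrow> \<exists>S. finite S \<and> S \<subseteq> K \<and> (\<forall>f\<in>K. \<exists>g\<in>S. d g f < \<epsilon>)"
    and approach: "\<And>g \<epsilon>. g \<in> K \<Longrightarrow> 0 < \<epsilon> \<Longrightarrow>
      AE \<omega> in M. \<forall>\<^sub>F n in sequentially. \<exists>f\<in>L n \<omega>. f \<in> E \<and> d f g < \<epsilon>"
    and \<epsilon>: "0 < \<epsilon>"
  shows "AE \<omega> in M. \<forall>\<^sub>F n in sequentially. K \<subseteq> enlargement E d (L n \<omega>) \<epsilon>"
proof -
  interpret Metric_space E d by (rule d)
  obtain S where S: "finite S" "S \<subseteq> K" "\<forall>f\<in>K. \<exists>g\<in>S. d g f < \<epsilon> / 2"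
    using tb[OF half_gt_zero[OF \<epsilon>]] by blast
  have "AE \<omega> in M. \<forall>g\<in>S. \<forall>\<^sub>F n in sequentially. \<exists>f\<in>L n \<omega>. f \<in> E \<and> d f g < \<epsilon> / 2"
  proof (rule AE_finite_allI[OF S(1)])
    fix g assume "g \<in> S"
    then have "g \<in> K" using S(2) by blast
    then show "AE \<omega> in M. \<forall>\<^sub>F n in sequentially. \<exists>f\<in>L n \<omega>. f \<in> E \<and> d f g < \<epsilon> / 2"
      by (rule approach[OF _ half_gt_zero[OF \<epsilon>]])
  qed
  then show ?thesis
  proof eventually_elim
    fix \<omega> assume "\<forall>g\<in>S. \<forall>\<^sub>F n in sequentially. \<exists>f\<in>L n \<omega>. f \<in> E \<and> d f g < \<epsilon> / 2"
    then have "\<forall>\<^sub>F n in sequentially. \<forall>g\<in>S. \<exists>f\<in>L n \<omega>. f \<in> E \<and> d f g < \<epsilon> / 2"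
      by (rule eventually_ball_finite[OF S(1)])
    then show "\<forall>\<^sub>F n in sequentially. K \<subseteq> enlargement E d (L n \<omega>) \<epsilon>"
    proof eventually_elim
      fix n assume n: "\<forall>g\<in>S. \<exists>f\<in>L n \<omega>. f \<in> E \<and> d f g < \<epsilon> / 2"
      show "K \<subseteq> enlargement E d (L n \<omega>) \<epsilon>"
      proof
        fix k assume k: "k \<in> K"
        then obtain g where g: "g \<in> S" "d g k < \<epsilon> / 2" using S(3) by blast
        then obtain f where f: "f \<in> L n \<omega>" "f \<in> E" "d f g < \<epsilon> / 2" using n by blast
        have E: "k \<in> E" "g \<in> E" using k g(1) S(2) KE by blast+
        have "d k f \<le> d k g + d g f" by (rule triangle[OF E f(2)])
        also have "\<dots> < \<epsilon>" using g(2) f(3) by (simp add: commute)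
        finally show "k \<in> enlargement E d (L n \<omega>) \<epsilon>"
          using f(1) E(1) unfolding enlargement_def by blast
      qed
    qed
  qed
qed

lemma increments_nat_subset: "increments_nat Z c n \<omega> \<subseteq> increments Z c n \<omega>"
  unfolding increments_nat_def increments_def by blast

text \<open>The integer part of an admissible starting point is again admissible, so the path from
  \<open>x\<close> is within \<epsilon> / 2 of one that starts at an integer, and that one is within
  \<epsilon> / 2 of \<open>K\<close>.\<close>

lemma AE_increments_near:
  assumes c: "0 < c" and d: "Metric_space E d" and KE: "K \<subseteq> E"
    and incr: "AE \<omega> in M. \<forall>x\<ge>0. \<forall>l>0. increment Z x l \<omega> \<in> E"
    and \<Delta>: "Delta_condition M Z c d"
    and near: "\<And>\<epsilon>. 0 < \<epsilon> \<Longrightarrow>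
      AE \<omega> in M. \<forall>\<^sub>F n in sequentially. increments_nat Z c n \<omega> \<subseteq> enlargement E d K \<epsilon>"
    and \<epsilon>: "0 < \<epsilon>"
  shows "AE \<omega> in M. \<forall>\<^sub>F n in sequentially. increments Z c n \<omega> \<subseteq> enlargement E d K \<epsilon>"
proof -
  interpret Metric_space E d by (rule d)
  have "infinitely_often_event (\<lambda>n. Delta_event M Z c d n (\<epsilon> / 2)) \<in> negligible_sets M"
    using \<Delta> \<epsilon> by (simp add: Delta_condition_def)
  from not_infinitely_often_AE[OF this] near[OF half_gt_zero[OF \<epsilon>]] incr AE_space
  show ?thesis
  proof eventually_elim
    fix \<omega>
    assume inE: "\<forall>x\<ge>0. \<forall>l>0. increment Z x l \<omega> \<in> E" and \<omega>: "\<omega> \<in> space M"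
    assume "\<forall>\<^sub>F n in sequentially. \<omega> \<notin> Delta_event M Z c d n (\<epsilon> / 2)"
      "\<forall>\<^sub>F n in sequentially. increments_nat Z c n \<omega> \<subseteq> enlargement E d K (\<epsilon> / 2)"
    moreover have "\<forall>\<^sub>F n in sequentially. 1 \<le> window c n"
      using eventually_compose_filterlim[OF eventually_ge_at_top filterlim_window[OF c]] .
    ultimately show "\<forall>\<^sub>F n in sequentially. increments Z c n \<omega> \<subseteq> enlargement E d K \<epsilon>"
    proof eventually_elim
      fix n
      assume n: "\<omega> \<notin> Delta_event M Z c d n (\<epsilon> / 2)"
        "increments_nat Z c n \<omega> \<subseteq> enlargement E d K (\<epsilon> / 2)" "1 \<le> window c n"
      have "increment Z x (window c n) \<omega> \<in> enlargement E d K \<epsilon>"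
        if x: "x \<in> {0..real n - real (window c n)}" for x
      proof -
        let ?f = "increment Z x (window c n) \<omega>"
        let ?h = "increment Z (of_int \<lfloor>x\<rfloor>) (window c n) \<omega>"
        have fl: "0 \<le> \<lfloor>x\<rfloor>" "of_int \<lfloor>x\<rfloor> \<le> x" using x by simp_all
        \<comment> \<open>The metric axioms of \<open>d\<close> hold on \<open>E\<close> only; the
          increments are in \<open>E\<close> because the window is positive.\<close>
        have E: "?f \<in> E" "?h \<in> E" using inE n(3) x fl by simp_all
        have fh: "d ?f ?h < \<epsilon> / 2" using n(1) x \<omega> by (auto simp: Delta_event_def not_le)
        have "real_of_int \<lfloor>x\<rfloor> \<in> \<nat>" using fl(1) by (metis of_nat_in_Nats of_int_of_nat_eq nonneg_int_cases)
        moreover have "real_of_int \<lfloor>x\<rfloor> \<le> real n - real (window c n)"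
          using fl(2) x unfolding atLeastAtMost_iff by linarith
        ultimately have "real_of_int \<lfloor>x\<rfloor> \<in> {0..real n - real (window c n)} \<inter> \<nat>"
          using fl(1) by simp
        then have "?h \<in> increments_nat Z c n \<omega>" unfolding increments_nat_def by blast
        then obtain g where g: "g \<in> K" "d ?h g < \<epsilon> / 2" using n(2) unfolding enlargement_def by blast
        have "d ?f g \<le> d ?f ?h + d ?h g" using E g(1) KE by (intro triangle) auto
        also have "\<dots> < \<epsilon>" using fh g(2) by simp
        finally show ?thesis using g(1) E(1) unfolding enlargement_def by blast
      qed
      then show "increments Z c n \<omega> \<subseteq> enlargement E d K \<epsilon>" unfolding increments_def by blast
    qed
  qed
qed

theorem theorem3:
  fixes M :: "'a measure" and Z :: "real \<Rightarrow> 'a \<Rightarrow> real" and c :: real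
    and E :: "path set" and d :: "path \<Rightarrow> path \<Rightarrow> real" and T :: "path topology"
    and I :: "path \<Rightarrow> ereal" and E' :: "real \<Rightarrow> path set"
  assumes levy: "levy_process M Z"
    and c: "0 < c"
    and E: "function_vector_space E"
    and incr: "AE \<omega> in M. \<forall>x\<ge>0. \<forall>l>0. increment Z x l \<omega> \<in> E"
    and d: "Metric_space E d"
    and T: "topspace T = E"
    and ray: "ray_continuous d (level_set E I (1 / c))"
    and A1: "ball_sigma_algebra E d \<subseteq> sets (borel_of T)"
      "sets (borel_of T) \<subseteq> sets (borel_of skorokhod_topology)"
    and A2: "large_deviations T (increment_law M Z) I" "good_rate_function T I"
    and A3: "\<And>\<alpha>. 0 < \<alpha> \<Longrightarrow> E' \<alpha> \<subseteq> E \<and> convex_paths (E' \<alpha>) \<and> null_path \<in> E' \<alpha> \<and>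
      level_set E I \<alpha> \<subseteq> E' \<alpha> \<and> Metric_space.mtopology (E' \<alpha>) d = subtopology T (E' \<alpha>)"
    and A4: "\<exists>\<delta>. Metric_space E \<delta> \<and>
      (\<forall>U. openin (Metric_space.mtopology E \<delta>) U \<longrightarrow> openin T U) \<and>
      (\<forall>\<alpha>>0. \<forall>K. compactin (Metric_space.mtopology (E' \<alpha>) d) K \<longrightarrow>
        (\<forall>g\<in>K. \<forall>\<epsilon>>0. \<exists>\<zeta>>0. {f \<in> E. \<delta> f g < \<zeta>} \<subseteq> {f \<in> E. d f g < \<epsilon>}))"
    and A5: "\<And>\<alpha>. 0 < \<alpha> \<Longrightarrow> convex_functional_on (E' \<alpha>) I" "I null_path = 0"
  shows "FERL M E d (increments_nat Z c) (level_set E I (1 / c)) \<and>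
    (Delta_condition M Z c d \<longrightarrow> FERL M E d (increments Z c) (level_set E I (1 / c)))"
proof -
  let ?K = "level_set E I (1 / c)"
  have c': "0 < 1 / c" using c by simp
  have E': "E' (1 / c) \<subseteq> E" "convex_paths (E' (1 / c))" "null_path \<in> E' (1 / c)" "?K \<subseteq> E' (1 / c)"
    "Metric_space.mtopology (E' (1 / c)) d = subtopology T (E' (1 / c))"
    using A3[OF c'] by simp_all
  from A4 obtain \<delta> where \<delta>: "Metric_space E \<delta>"
    and weaker: "\<forall>U. openin (Metric_space.mtopology E \<delta>) U \<longrightarrow> openin T U"
    and fine: "\<forall>\<alpha>>0. \<forall>K. compactin (Metric_space.mtopology (E' \<alpha>) d) K \<longrightarrow>
        (\<forall>g\<in>K. \<forall>\<epsilon>>0. \<exists>\<zeta>>0. {f \<in> E. \<delta> f g < \<zeta>} \<subseteq> {f \<in> E. d f g < \<epsilon>})"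
    by (elim exE conjE)
  interpret Metric_space E d by (rule d)
  have KE: "?K \<subseteq> E" by (auto simp: level_set_def)
  have K: "compactin (Metric_space.mtopology (E' (1 / c)) d) ?K"
    by (rule level_set_compactin[OF T A2(2) E'(4,5)])
  \<comment> \<open>(A4) is applied with \<open>?K\<close> itself as the compact set, so it is
    available at each point of \<open>?K\<close>.\<close>
  have fine: "\<exists>\<zeta>>0. {f \<in> E. \<delta> f g < \<zeta>} \<subseteq> {f \<in> E. d f g < \<epsilon>}"
    if "g \<in> ?K" "0 < \<epsilon>" for g \<epsilon>
    using fine[rule_format, OF c' K that] .
  have near: "AE \<omega> in M. \<forall>\<^sub>F n in sequentially. increments_nat Z c n \<omega> \<subseteq> enlargement E d ?K \<epsilon>"
    if "0 < \<epsilon>" for \<epsilon>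
    by (rule AE_increments_nat_near_level_set[OF levy c incr T A1(2) A2 \<delta> weaker]) (erule fine[OF _ that])
  have tb: "\<exists>S. finite S \<and> S \<subseteq> ?K \<and> (\<forall>f\<in>?K. \<exists>g\<in>S. d g f < \<epsilon>)" if \<epsilon>: "0 < \<epsilon>" for \<epsilon>
  proof -
    \<comment> \<open>Compactness for \<open>d\<close> is known inside \<open>E' (1 / c)\<close>;
      the finite net it provides consists of points of \<open>?K\<close>.\<close>
    interpret E': Metric_space "E' (1 / c)" d
      by (rule subspace[OF E'(1)])
    have "E'.mtotally_bounded ?K" using K by (rule E'.compactin_imp_mtotally_bounded)
    from this[unfolded E'.mtotally_bounded_def, rule_format, OF \<epsilon>]
    obtain S where S: "finite S" "S \<subseteq> ?K" "?K \<subseteq> (\<Union>x\<in>S. E'.mball x \<epsilon>)"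
      by (elim exE conjE)
    have "\<exists>g\<in>S. d g f < \<epsilon>" if "f \<in> ?K" for f
      using subsetD[OF S(3) that] by (elim UN_E) (auto simp only: E'.in_mball)
    then show ?thesis using S(1,2) by (intro exI[of _ S] conjI ballI)
  qed
  have approach: "AE \<omega> in M. \<forall>\<^sub>F n in sequentially. \<exists>f\<in>increments_nat Z c n \<omega>. f \<in> E \<and> d f g < \<epsilon>"
    if g: "g \<in> ?K" and \<epsilon>: "0 < \<epsilon>" for g \<epsilon>
  proof -
    have gE: "g \<in> E" using g KE by blast
    from level_set_approximation[OF c E ray E'(2-4) A5(1)[OF c'] A5(2) g half_gt_zero[OF \<epsilon>]]
    obtain h b where h: "h \<in> ?K" "d h g < \<epsilon> / 2" "I h < ereal b" "0 \<le> b" "b < 1 / c"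
      by blast
    have hE: "h \<in> E" using h(1) KE by blast
    \<comment> \<open>The approximant \<open>h\<close> is itself a point of \<open>?K\<close>, which
      allows (A4) at \<open>h\<close> and turns closeness in \<delta> into closeness in
      \<open>d\<close>.\<close>
    obtain \<zeta> where \<zeta>: "0 < \<zeta>" "{f \<in> E. \<delta> f h < \<zeta>} \<subseteq> {f \<in> E. d f h < \<epsilon> / 2}"
      using fine[OF h(1) half_gt_zero[OF \<epsilon>]] by blast
    have close: "d f g < \<epsilon>" if f: "f \<in> E" "\<delta> f h < \<zeta>" for f
    proof -
      have "d f g \<le> d f h + d h g" by (rule triangle[OF f(1) hE gE])
      also have "d f h < \<epsilon> / 2" using \<zeta>(2) f by blast
      also note h(2)
      finally show ?thesis by simp
    qed
    from AE_increments_nat_approach[OF levy c T A1(2) A2(1) \<delta> weaker hE h(3-5) \<zeta>(1)]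
    show ?thesis
    proof eventually_elim
      fix \<omega> assume "\<forall>\<^sub>F n in sequentially. \<exists>f\<in>increments_nat Z c n \<omega>. f \<in> E \<and> \<delta> f h < \<zeta>"
      then show "\<forall>\<^sub>F n in sequentially. \<exists>f\<in>increments_nat Z c n \<omega>. f \<in> E \<and> d f g < \<epsilon>"
        by eventually_elim (use close in blast)
    qed
  qed
  have covered: "AE \<omega> in M. \<forall>\<^sub>F n in sequentially. ?K \<subseteq> enlargement E d (increments_nat Z c n \<omega>) \<epsilon>"
    if "0 < \<epsilon>" for \<epsilon>
    by (rule AE_totally_bounded_near[OF d KE _ _ that]) (erule tb, erule (1) approach)
  \<comment> \<open>This half of the law is monotone in the family of increments: integer starting
    points are among the real ones.\<close>
  have covered': "AE \<omega> in M. \<forall>\<^sub>F n in sequentially. ?K \<subseteq> enlargement E d (increments Z c n \<omega>) \<epsilon>"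
    if "0 < \<epsilon>" for \<epsilon>
    using covered[OF that]
  proof eventually_elim
    fix \<omega> assume "\<forall>\<^sub>F n in sequentially. ?K \<subseteq> enlargement E d (increments_nat Z c n \<omega>) \<epsilon>"
    then show "\<forall>\<^sub>F n in sequentially. ?K \<subseteq> enlargement E d (increments Z c n \<omega>) \<epsilon>"
    proof eventually_elim
      fix n assume "?K \<subseteq> enlargement E d (increments_nat Z c n \<omega>) \<epsilon>"
      also have "\<dots> \<subseteq> enlargement E d (increments Z c n \<omega>) \<epsilon>"
        using increments_nat_subset[of Z c n \<omega>] unfolding enlargement_def by blast
      finally show "?K \<subseteq> enlargement E d (increments Z c n \<omega>) \<epsilon>" .
    qed
  qed
  have "FERL M E d (increments_nat Z c) ?K"
    by (rule FERL_I[OF KE]) (erule near, erule covered)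
  \<comment> \<open>\<open>Delta_condition\<close> enters in the other half, where starting points
    between integers have to be controlled.\<close>
  moreover have "FERL M E d (increments Z c) ?K" if \<Delta>: "Delta_condition M Z c d"
  proof (rule FERL_I[OF KE _ covered'])
    show "AE \<omega> in M. \<forall>\<^sub>F n in sequentially. increments Z c n \<omega> \<subseteq> enlargement E d ?K \<epsilon>"
      if "0 < \<epsilon>" for \<epsilon>
      by (rule AE_increments_near[OF c d KE incr \<Delta> _ that]) (erule near)
  qed
  ultimately show ?thesis by blast
qed

end
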